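(* The functor $K\colon\mathbf{s2t\text{-}Gp}\to\mathbf{n\text{-}Dom}$ given on objects by $(G,\Omega,\omega_0,\omega_1)\mapsto(\Omega,+_0,\cdot_1)$ and on morphisms by sending $(f,\Phi)\colon(G,\Omega,\omega_0,\omega_1)\to(H,\Sigma,\sigma_0,\sigma_1)$ to $\Phi\colon(\Omega,+_0,\cdot_1)\to(\Sigma,+_{0'},\cdot_{1'})$ (where $+_{0'},\cdot_{1'}$ are the operations on $\Sigma$ constructed in the same way from $(H,\Sigma,\sigma_0,\sigma_1)$) is an equivalence of categories.
   Context: A loop is a set with a binary operation having a two-sided identity such that for all $a,b$ the equations $ax=b$ and $ya=b$ have unique solutions $x$, $y$. A neardomain is a triple $(F,+,\cdot)$ such that: (1) $(F,+)$ is a loop with neutral element $0$; (2) for all $a,b\in F$, $a+b=0$ implies $b+a=0$; (3) $(F\setminus\{0\},\cdot)$ is a group with neutral element $1$; (4) $0\cdot a=0$ for all $a\in F$; (5) $a\cdot(b+c)=a\cdot b+a\cdot c$ for all $a,b,c\in F$; (6) for all $a,b\in F$ there is $d_{a,b}\in F\setminus\{0\}$ such that $a+(b+x)=(a+b)+d_{a,b}\cdot x$ for all $x\in F$. The category $\mathbf{n\text{-}Dom}$ has neardomains as objects; morphisms $(F,+,\cdot)\to(F',+',\cdot')$ are the maps $f\colon F\to F'$ preserving both operations. Let $G$ be a permutation group acting sharply $2$-transitively on a set $\Omega$ with $\#\Omega\ge2$ (for any ordered pairs $(\alpha_1,\alpha_2)$, $(\beta_1,\beta_2)$ of points of $\Omega$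 with $\alpha_1\ne\alpha_2$, $\beta_1\neq\beta_2$ there is a unique $g\in G$ with $g(\alpha_i)=\beta_i$ for $i=1,2$). Let $J=\{g\in G\mid g^2=1_\Omega\ne g\}$. It is known that either all $j\in J$ are fixpoint-free, in which case one writes $\operatorname{char}G=2$, or every $j\in J$ has a unique fixpoint, in which case one writes $\operatorname{char}G\ne2$. Given a base point $\omega_0\in\Omega$, if $\operatorname{char}G\ne2$ let $\nu$ be the unique involution in $G$ fixing $\omega_0$. Put $A=J\circ\nu=\{j\circ\nu\mid j\in J\}$ if $\operatorname{char}G\neq2$ and $A=J\cup\{1_\Omega\}$ if $\operatorname{char}G=2$. It is known that $A$ contains $1_\Omega$ and acts regularly on $\Omega$ (for all $\alpha,\beta\in\Omega$ there is a unique $a\in A$ with $a(\alpha)=\beta$). The category $\mathbf{s2t\text{-}Gp}$: objects are quadruples $(G,\Omega,\omega_0,\omega_1)$ where $G$ is a permutation group acting sharply $2$-transitively on $\Omega$ ($\#\Omega\ge2$) and $\omega_0\ne\omega_1$ are base points in $\Omega$. If either both $\operatorname{char}G=2$ and $\operatorname{char}H=2$ or both $\operatorname{char}G\ne2$ and $\operatorname{char}H\neq2$, a morphism $(G,\Omega,\omega_0,\omega_1)\to(H,\Sigma,\sigma_0,\sigma_1)$ is a pair $(f,\Phi)$ with $f\colon G\to H$ a group homomorphism and $\Phi\colon\Omega\to\Sigma$ an injective map with $\Phi(\omega_0)=\sigma_0$, $\Phi(\omega_1)=\sigma_1$ and $\Phi(g(\omega))=f(g)(\Phi(\omega))$ for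 all $g\in G$, $\omega\in\Omega$. If exactly one of $G,H$ has characteristic $2$, there are no morphisms. Composition is componentwise. For an object $(G,\Omega,\omega_0,\omega_1)$ define on $\Omega$: $\alpha+_0\beta=a(\beta)$, where $a\in A$ is the unique element with $a(\omega_0)=\alpha$; and $\alpha\cdot_1\beta=g(\beta)$ for $\alpha,\beta\neq\omega_0$, where $g$ is the unique element of the stabilizer $G_{\omega_0}$ with $g(\omega_1)=\alpha$, while $\alpha\cdot_1\beta=\omega_0$ if $\alpha=\omega_0$ or $\beta=\omega_0$. It is known that $(\Omega,+_0,\cdot_1)$ is a neardomain (with zero $\omega_0$ and multiplicative identity $\omega_1$).
   Formalization: Morphisms of neardomains are also required to preserve 1, which excludes exactly the zero maps; with the zero map (e.g. from GF(2) to itself) allowed as a map preserving both operations, K would not be full and the claim would be false. *)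

theory Defs
  imports "HOL-Algebra.Bij" "HOL-Algebra.Ring"
begin

section \<open>Categories, functors and equivalences\<close>

text \<open>
  Hom-sets of different pairs of objects need not be disjoint, so composition, identities and the
  action of a functor on morphisms are indexed by the objects involved:
  \<open>cmp C X Y Z g f\<close> is the composite of \<open>f : X \<rightarrow> Y\<close> and \<open>g : Y \<rightarrow> Z\<close>.
\<close>

record ('o, 'm) cat =
  obj :: "'o set"
  hom_set :: "'o \<Rightarrow> 'o \<Rightarrow> 'm set"
  cmp :: "'o \<Rightarrow> 'o \<Rightarrow> 'o \<Rightarrow> 'm \<Rightarrow> 'm \<Rightarrow> 'm"
  idm :: "'o \<Rightarrow> 'm"

definition is_category :: "('o, 'm) cat \<Rightarrow> bool" where
  "is_category C \<longleftrightarrow>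
    (\<forall>X\<in>obj C. idm C X \<in> hom_set C X X) \<and>
    (\<forall>X\<in>obj C. \<forall>Y\<in>obj C. \<forall>Z\<in>obj C. \<forall>f\<in>hom_set C X Y. \<forall>g\<in>hom_set C Y Z.
       cmp C X Y Z g f \<in> hom_set C X Z) \<and>
    (\<forall>X\<in>obj C. \<forall>Y\<in>obj C. \<forall>f\<in>hom_set C X Y.
       cmp C X X Y f (idm C X) = f \<and> cmp C X Y Y (idm C Y) f = f) \<and>
    (\<forall>W\<in>obj C. \<forall>X\<in>obj C. \<forall>Y\<in>obj C. \<forall>Z\<in>obj C.
       \<forall>f\<in>hom_set C W X. \<forall>g\<in>hom_set C X Y. \<forall>h\<in>hom_set C Y Z.
         cmp C W Y Z h (cmp C W X Y g f) = cmp C W X Z (cmp C X Y Z h g) f)"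

record ('o1, 'm1, 'o2, 'm2) funct =
  on_obj :: "'o1 \<Rightarrow> 'o2"
  on_mor :: "'o1 \<Rightarrow> 'o1 \<Rightarrow> 'm1 \<Rightarrow> 'm2"

definition is_functor ::
  "('o1, 'm1) cat \<Rightarrow> ('o2, 'm2) cat \<Rightarrow> ('o1, 'm1, 'o2, 'm2) funct \<Rightarrow> bool" where
  "is_functor C D F \<longleftrightarrow>
    is_category C \<and> is_category D \<and>
    (\<forall>X\<in>obj C. on_obj F X \<in> obj D) \<and>
    (\<forall>X\<in>obj C. \<forall>Y\<in>obj C. \<forall>f\<in>hom_set C X Y.
       on_mor F X Y f \<in> hom_set D (on_obj F X) (on_obj F Y)) \<and>
    (\<forall>X\<in>obj C. on_mor F X X (idm C X) = idm D (on_obj F X)) \<and>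
    (\<forall>X\<in>obj C. \<forall>Y\<in>obj C. \<forall>Z\<in>obj C. \<forall>f\<in>hom_set C X Y. \<forall>g\<in>hom_set C Y Z.
       on_mor F X Z (cmp C X Y Z g f) =
       cmp D (on_obj F X) (on_obj F Y) (on_obj F Z) (on_mor F Y Z g) (on_mor F X Y f))"

definition id_functor :: "('o, 'm, 'o, 'm) funct" where
  "id_functor = \<lparr>on_obj = (\<lambda>X. X), on_mor = (\<lambda>X Y f. f)\<rparr>"

definition comp_functor ::
  "('o2, 'm2, 'o3, 'm3) funct \<Rightarrow> ('o1, 'm1, 'o2, 'm2) funct \<Rightarrow> ('o1, 'm1, 'o3, 'm3) funct" where
  "comp_functor G F =
    \<lparr>on_obj = (\<lambda>X. on_obj G (on_obj F X)),
     on_mor = (\<lambda>X Y f. on_mor G (on_obj F X) (on_obj F Y) (on_mor F X Y f))\<rparr>"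

definition isomorphisms :: "('o, 'm) cat \<Rightarrow> 'o \<Rightarrow> 'o \<Rightarrow> 'm set" where
  "isomorphisms C X Y =
    {f \<in> hom_set C X Y. \<exists>g\<in>hom_set C Y X.
       cmp C X Y X g f = idm C X \<and> cmp C Y X Y f g = idm C Y}"

definition naturally_isomorphic ::
  "('o1, 'm1) cat \<Rightarrow> ('o2, 'm2) cat \<Rightarrow> ('o1, 'm1, 'o2, 'm2) funct \<Rightarrow>
   ('o1, 'm1, 'o2, 'm2) funct \<Rightarrow> bool" where
  "naturally_isomorphic C D F G \<longleftrightarrow>
    (\<exists>\<eta>. (\<forall>X\<in>obj C. \<eta> X \<in> isomorphisms D (on_obj F X) (on_obj G X)) \<and>
      (\<forall>X\<in>obj C. \<forall>Y\<in>obj C. \<forall>f\<in>hom_set C X Y.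
         cmp D (on_obj F X) (on_obj F Y) (on_obj G Y) (\<eta> Y) (on_mor F X Y f) =
         cmp D (on_obj F X) (on_obj G X) (on_obj G Y) (on_mor G X Y f) (\<eta> X)))"

definition is_equivalence ::
  "('o1, 'm1) cat \<Rightarrow> ('o2, 'm2) cat \<Rightarrow> ('o1, 'm1, 'o2, 'm2) funct \<Rightarrow> bool" where
  "is_equivalence C D F \<longleftrightarrow>
    is_functor C D F \<and>
    (\<exists>G. is_functor D C G \<and>
      naturally_isomorphic C C (comp_functor G F) id_functor \<and>
      naturally_isomorphic D D (comp_functor F G) id_functor)"

section \<open>Neardomains\<close>

definition is_loop :: "('a, 'b) monoid_scheme \<Rightarrow> bool" where
  "is_loop L \<longleftrightarrow>
    (\<forall>a\<in>carrier L. \<forall>b\<in>carrier L. a \<otimes>\<^bsub>L\<^esub> b \<in> carrier L) \<and>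
    \<one>\<^bsub>L\<^esub> \<in> carrier L \<and>
    (\<forall>a\<in>carrier L. \<one>\<^bsub>L\<^esub> \<otimes>\<^bsub>L\<^esub> a = a \<and> a \<otimes>\<^bsub>L\<^esub> \<one>\<^bsub>L\<^esub> = a) \<and>
    (\<forall>a\<in>carrier L. \<forall>b\<in>carrier L.
       (\<exists>!x. x \<in> carrier L \<and> a \<otimes>\<^bsub>L\<^esub> x = b) \<and>
       (\<exists>!y. y \<in> carrier L \<and> y \<otimes>\<^bsub>L\<^esub> a = b))"

text \<open>
  The record type \<open>ring\<close> is only used as a signature; its fields \<open>zero\<close> and \<open>one\<close> are
  determined by the two operations. The values of the operations outside the carrier are irrelevant.
\<close>

definition is_neardomain :: "'a ring \<Rightarrow> bool" where
  "is_neardomain F \<longleftrightarrow>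
    (\<forall>a\<in>carrier F. \<forall>b\<in>carrier F. a \<otimes>\<^bsub>F\<^esub> b \<in> carrier F) \<and>
    is_loop \<lparr>carrier = carrier F, mult = add F, one = \<zero>\<^bsub>F\<^esub>\<rparr> \<and>
    (\<forall>a\<in>carrier F. \<forall>b\<in>carrier F. a \<oplus>\<^bsub>F\<^esub> b = \<zero>\<^bsub>F\<^esub> \<longrightarrow> b \<oplus>\<^bsub>F\<^esub> a = \<zero>\<^bsub>F\<^esub>) \<and>
    group \<lparr>carrier = carrier F - {\<zero>\<^bsub>F\<^esub>}, mult = mult F, one = \<one>\<^bsub>F\<^esub>\<rparr> \<and>
    (\<forall>a\<in>carrier F. \<zero>\<^bsub>F\<^esub> \<otimes>\<^bsub>F\<^esub> a = \<zero>\<^bsub>F\<^esub>) \<and>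
    (\<forall>a\<in>carrier F. \<forall>b\<in>carrier F. \<forall>c\<in>carrier F.
       a \<otimes>\<^bsub>F\<^esub> (b \<oplus>\<^bsub>F\<^esub> c) = (a \<otimes>\<^bsub>F\<^esub> b) \<oplus>\<^bsub>F\<^esub> (a \<otimes>\<^bsub>F\<^esub> c)) \<and>
    (\<forall>a\<in>carrier F. \<forall>b\<in>carrier F. \<exists>d\<in>carrier F - {\<zero>\<^bsub>F\<^esub>}. \<forall>x\<in>carrier F.
       a \<oplus>\<^bsub>F\<^esub> (b \<oplus>\<^bsub>F\<^esub> x) = (a \<oplus>\<^bsub>F\<^esub> b) \<oplus>\<^bsub>F\<^esub> (d \<otimes>\<^bsub>F\<^esub> x))"

text \<open>
  \<^const>\<open>ring_hom\<close> asks for maps preserving addition, multiplication and \<open>one\<close>. Preservation of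
  \<open>one\<close> only excludes the zero map, which preserves both operations but does not restrict to a
  homomorphism of the multiplicative groups; with the zero map as a morphism the category would
  not be equivalent to the category of sharply 2-transitive groups, all of whose morphisms are
  given by injective maps.

  Maps between carriers are extensional, so that equal morphisms are equal as HOL functions.
  All carriers are subsets of one arbitrary type, which plays the role of the universe.
\<close>

definition n_Dom :: "('a ring, 'a \<Rightarrow> 'a) cat" where
  "n_Dom =
    \<lparr>obj = {F. is_neardomain F},
     hom_set = (\<lambda>F F'. ring_hom F F' \<inter> extensional (carrier F)),
     cmp = (\<lambda>F F' F'' g f. compose (carrier F) g f),
     idm = (\<lambda>F. \<lambda>x\<in>carrier F. x)\<rparr>"

section \<open>Sharply 2-transitive permutation groups\<close>

definition sharply_2_transitive :: "('a \<Rightarrow> 'a) set \<Rightarrow> 'a set \<Rightarrow> bool" where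
  "sharply_2_transitive G \<Omega> \<longleftrightarrow>
    subgroup G (BijGroup \<Omega>) \<and>
    (\<exists>\<alpha>\<in>\<Omega>. \<exists>\<beta>\<in>\<Omega>. \<alpha> \<noteq> \<beta>) \<and>
    (\<forall>\<alpha>1\<in>\<Omega>. \<forall>\<alpha>2\<in>\<Omega>. \<forall>\<beta>1\<in>\<Omega>. \<forall>\<beta>2\<in>\<Omega>. \<alpha>1 \<noteq> \<alpha>2 \<and> \<beta>1 \<noteq> \<beta>2 \<longrightarrow>
       (\<exists>!g. g \<in> G \<and> g \<alpha>1 = \<beta>1 \<and> g \<alpha>2 = \<beta>2))"

definition involutions :: "('a \<Rightarrow> 'a) set \<Rightarrow> 'a set \<Rightarrow> ('a \<Rightarrow> 'a) set" where
  "involutions G \<Omega> = {g \<in> G. compose \<Omega> g g = (\<lambda>x\<in>\<Omega>. x) \<and> g \<noteq> (\<lambda>x\<in>\<Omega>. x)}"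

definition char_2 :: "('a \<Rightarrow> 'a) set \<Rightarrow> 'a set \<Rightarrow> bool" where
  "char_2 G \<Omega> \<longleftrightarrow> (\<forall>j\<in>involutions G \<Omega>. \<forall>x\<in>\<Omega>. j x \<noteq> x)"

definition base_involution :: "('a \<Rightarrow> 'a) set \<Rightarrow> 'a set \<Rightarrow> 'a \<Rightarrow> 'a \<Rightarrow> 'a" where
  "base_involution G \<Omega> \<omega>0 = (THE j. j \<in> involutions G \<Omega> \<and> j \<omega>0 = \<omega>0)"

definition regular_set :: "('a \<Rightarrow> 'a) set \<Rightarrow> 'a set \<Rightarrow> 'a \<Rightarrow> ('a \<Rightarrow> 'a) set" where
  "regular_set G \<Omega> \<omega>0 =
    (if char_2 G \<Omega> then involutions G \<Omega> \<union> {\<lambda>x\<in>\<Omega>. x}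
     else {compose \<Omega> j (base_involution G \<Omega> \<omega>0) | j. j \<in> involutions G \<Omega>})"

record 'a s2t =
  grp :: "('a \<Rightarrow> 'a) set"
  pts :: "'a set"
  base0 :: 'a
  base1 :: 'a

definition is_s2t :: "'a s2t \<Rightarrow> bool" where
  "is_s2t X \<longleftrightarrow>
    sharply_2_transitive (grp X) (pts X) \<and>
    base0 X \<in> pts X \<and> base1 X \<in> pts X \<and> base0 X \<noteq> base1 X"

abbreviation perm_group :: "'a s2t \<Rightarrow> ('a \<Rightarrow> 'a) monoid" where
  "perm_group X \<equiv> (BijGroup (pts X))\<lparr>carrier := grp X\<rparr>"

definition s2t_hom :: "'a s2t \<Rightarrow> 'a s2t \<Rightarrow> ((('a \<Rightarrow> 'a) \<Rightarrow> ('a \<Rightarrow> 'a)) \<times> ('a \<Rightarrow> 'a)) set" where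
  "s2t_hom X Y =
    {(f, \<Phi>).
       (char_2 (grp X) (pts X) \<longleftrightarrow> char_2 (grp Y) (pts Y)) \<and>
       f \<in> hom (perm_group X) (perm_group Y) \<and> f \<in> extensional (grp X) \<and>
       \<Phi> \<in> pts X \<rightarrow>\<^sub>E pts Y \<and> inj_on \<Phi> (pts X) \<and>
       \<Phi> (base0 X) = base0 Y \<and> \<Phi> (base1 X) = base1 Y \<and>
       (\<forall>g\<in>grp X. \<forall>\<omega>\<in>pts X. \<Phi> (g \<omega>) = f g (\<Phi> \<omega>))}"

definition s2t_Gp :: "('a s2t, (('a \<Rightarrow> 'a) \<Rightarrow> ('a \<Rightarrow> 'a)) \<times> ('a \<Rightarrow> 'a)) cat" where
  "s2t_Gp =
    \<lparr>obj = {X. is_s2t X},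
     hom_set = s2t_hom,
     cmp = (\<lambda>X Y Z (f', \<Phi>') (f, \<Phi>). (compose (grp X) f' f, compose (pts X) \<Phi>' \<Phi>)),
     idm = (\<lambda>X. (\<lambda>g\<in>grp X. g, \<lambda>\<omega>\<in>pts X. \<omega>))\<rparr>"

section \<open>The functor\<close>

definition s2t_add :: "'a s2t \<Rightarrow> 'a \<Rightarrow> 'a \<Rightarrow> 'a" where
  "s2t_add X \<alpha> \<beta> =
    (THE a. a \<in> regular_set (grp X) (pts X) (base0 X) \<and> a (base0 X) = \<alpha>) \<beta>"

definition s2t_mult :: "'a s2t \<Rightarrow> 'a \<Rightarrow> 'a \<Rightarrow> 'a" where
  "s2t_mult X \<alpha> \<beta> =
    (if \<alpha> = base0 X \<or> \<beta> = base0 X then base0 X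
     else (THE g. g \<in> grp X \<and> g (base0 X) = base0 X \<and> g (base1 X) = \<alpha>) \<beta>)"

definition functor_K ::
  "('a s2t, (('a \<Rightarrow> 'a) \<Rightarrow> ('a \<Rightarrow> 'a)) \<times> ('a \<Rightarrow> 'a), 'a ring, 'a \<Rightarrow> 'a) funct" where
  "functor_K =
    \<lparr>on_obj = (\<lambda>X. \<lparr>carrier = pts X, mult = s2t_mult X, one = base1 X,
                    zero = base0 X, add = s2t_add X\<rparr>),
     on_mor = (\<lambda>X Y (f, \<Phi>). \<Phi>)\<rparr>"

end

theory Submission
  imports Defs
begin

text \<open>
  A neardomain \<open>F\<close> has the affine group of all maps \<open>x \<mapsto> a + m x\<close> with \<open>m \<noteq> 0\<close>; with base points
  \<open>0\<close> and \<open>1\<close> it is an object of the category of sharply 2-transitive groups. This construction is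
  an inverse of \<open>K\<close> up to isomorphism.

  In one direction nothing changes at all: if \<open>g\<close> is an element of a sharply 2-transitive group \<open>G\<close>
  and \<open>a\<close> is the element of the regular set \<open>A\<close> that moves the base point to the same place as \<open>g\<close>,
  then \<open>a\<inverse> g\<close> fixes the base point, so it is a multiplication of \<open>K G\<close>. Hence \<open>G\<close> is exactly the
  affine group of \<open>K G\<close> (\<open>affine_s2t_functor_K\<close>).

  In the other direction one has to find back the addition of \<open>F\<close>, that is, to show that the regular
  set of the affine group consists of the maps \<open>x \<mapsto> a + x\<close> (\<open>affine_translation_set\<close>). Let
  \<open>e = -1\<close>. If \<open>e = 1\<close>, these maps are involutions without fixpoints. Otherwise \<open>x \<mapsto> e x\<close> is an
  involution that fixes \<open>0\<close>; it is the only one, hence invariant under conjugation by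
  multiplications, so \<open>e\<close> is central, and therefore the maps \<open>x \<mapsto> a + e x\<close> are involutions. The
  composite of such a map with \<open>x \<mapsto> e x\<close> is \<open>x \<mapsto> a + x\<close>.

  Both directions, and the fact that \<open>K G\<close> is a neardomain, rest on the regularity of \<open>A\<close>, whose core
  is that a point is fixed by at most one involution (\<open>involution_fixing_unique\<close>).

  On morphisms, the group homomorphism \<open>f\<close> of a pair \<open>(f, \<Phi>)\<close> is determined by \<open>\<Phi>\<close>, because \<open>f g\<close>
  is known on the two base points (\<open>s2t_hom_eqI\<close>). So every equation between morphisms of
  sharply 2-transitive groups can be checked on points, and a homomorphism \<open>\<phi>\<close> of neardomains, which
  is automatically injective, extends uniquely to the affine groups by
  \<open>(x \<mapsto> a + m x) \<mapsto> (x \<mapsto> \<phi> a + \<phi> m x)\<close>. It respects the characteristic, because the affine group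
  has characteristic 2 exactly if \<open>1 + 1 = 0\<close> (\<open>char_2_affine\<close>).
\<close>

section \<open>Sharply 2-transitive permutation groups\<close>

locale sharply_2_transitive_group =
  fixes G :: "('a \<Rightarrow> 'a) set" and \<Omega> :: "'a set"
  assumes sharply: "sharply_2_transitive G \<Omega>"
begin

abbreviation J where "J \<equiv> involutions G \<Omega>"

lemma subgroup: "subgroup G (BijGroup \<Omega>)"
  using sharply by (simp add: sharply_2_transitive_def)

lemma in_Bij: "g \<in> G \<Longrightarrow> g \<in> Bij \<Omega>"
  using subgroup.subset[OF subgroup] by (auto simp: BijGroup_def)

lemma bij: "g \<in> G \<Longrightarrow> bij_betw g \<Omega> \<Omega>"
  using in_Bij by (simp add: Bij_def)

lemma closed [simp]: "g \<in> G \<Longrightarrow> x \<in> \<Omega> \<Longrightarrow> g x \<in> \<Omega>"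
  using bij bij_betwE by blast

lemma inj_iff [simp]: "g \<in> G \<Longrightarrow> x \<in> \<Omega> \<Longrightarrow> y \<in> \<Omega> \<Longrightarrow> g x = g y \<longleftrightarrow> x = y"
  using bij by (metis bij_betw_def inj_on_eq_iff)

lemma extensional: "g \<in> G \<Longrightarrow> g \<in> extensional \<Omega>"
  using in_Bij by (simp add: Bij_def)

lemma compose_closed: "g \<in> G \<Longrightarrow> h \<in> G \<Longrightarrow> compose \<Omega> g h \<in> G"
  using subgroup.m_closed[OF subgroup, of g h] in_Bij by (simp add: BijGroup_def)

lemma id_closed: "(\<lambda>x\<in>\<Omega>. x) \<in> G"
  using subgroup.one_closed[OF subgroup] by (simp add: BijGroup_def)

lemma inverse:
  assumes "g \<in> G"
  obtains h where "h \<in> G" "\<And>x. x \<in> \<Omega> \<Longrightarrow> h (g x) = x" "\<And>x. x \<in> \<Omega> \<Longrightarrow> g (h x) = x"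
proof
  let ?h = "inv\<^bsub>BijGroup \<Omega>\<^esub> g"
  have h: "?h = (\<lambda>x\<in>\<Omega>. (inv_into \<Omega> g) x)"
    by (rule inv_BijGroup[OF in_Bij[OF assms]])
  show "?h \<in> G"
    by (rule subgroup.m_inv_closed[OF subgroup assms])
  show "?h (g x) = x" if "x \<in> \<Omega>" for x
    using that bij[OF assms] assms by (simp add: h bij_betw_def inv_into_f_f)
  show "g (?h x) = x" if "x \<in> \<Omega>" for x
    using that bij[OF assms] by (simp add: h bij_betw_def f_inv_into_f)
qed

lemma eqI_pointwise:
  assumes "g \<in> G" "h \<in> G" "\<And>x. x \<in> \<Omega> \<Longrightarrow> g x = h x"
  shows "g = h"
  using extensionalityI[OF extensional extensional] assms by blast

lemma exists_two_points: "\<exists>x\<in>\<Omega>. \<exists>y\<in>\<Omega>. x \<noteq> y"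
  using sharply by (auto simp: sharply_2_transitive_def)

lemma ex1_transport:
  assumes "x \<in> \<Omega>" "y \<in> \<Omega>" "x' \<in> \<Omega>" "y' \<in> \<Omega>" "x \<noteq> y" "x' \<noteq> y'"
  shows "\<exists>!g. g \<in> G \<and> g x = x' \<and> g y = y'"
  using sharply assms unfolding sharply_2_transitive_def by blast

lemma transport:
  assumes "x \<in> \<Omega>" "y \<in> \<Omega>" "x' \<in> \<Omega>" "y' \<in> \<Omega>" "x \<noteq> y" "x' \<noteq> y'"
  obtains g where "g \<in> G" "g x = x'" "g y = y'"
  using ex1_transport[OF assms] by blast

lemma eqI_two_points:
  assumes "g \<in> G" "h \<in> G" "x \<in> \<Omega>" "y \<in> \<Omega>" "x \<noteq> y" "g x = h x" "g y = h y"
  shows "g = h"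
  using ex1_transport[of x y "h x" "h y"] assms by auto

lemma id_if_two_fixpoints:
  assumes "g \<in> G" "x \<in> \<Omega>" "y \<in> \<Omega>" "x \<noteq> y" "g x = x" "g y = y" "z \<in> \<Omega>"
  shows "g z = z"
  using eqI_two_points[OF assms(1) id_closed assms(2,3,4)] assms by simp

lemma involution_iff:
  "j \<in> J \<longleftrightarrow> j \<in> G \<and> (\<forall>x\<in>\<Omega>. j (j x) = x) \<and> (\<exists>x\<in>\<Omega>. j x \<noteq> x)"
proof (cases "j \<in> G")
  case True
  have "compose \<Omega> j j = (\<lambda>x\<in>\<Omega>. x) \<longleftrightarrow> (\<forall>x\<in>\<Omega>. j (j x) = x)"
    unfolding fun_eq_iff compose_def restrict_def by auto
  moreover have "j = (\<lambda>x\<in>\<Omega>. x) \<longleftrightarrow> (\<forall>x\<in>\<Omega>. j x = x)"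
    using eqI_pointwise[OF True id_closed] by (metis restrict_apply')
  ultimately show ?thesis
    using True by (auto simp: involutions_def)
qed (simp add: involutions_def)

lemma involutionI:
  assumes "j \<in> G" "\<And>x. x \<in> \<Omega> \<Longrightarrow> j (j x) = x" "y \<in> \<Omega>" "j y \<noteq> y"
  shows "j \<in> J"
  using assms by (auto simp only: involution_iff)

lemma involution_in [simp]: "j \<in> J \<Longrightarrow> j \<in> G"
  by (simp only: involution_iff)

lemma involution_involutory [simp]: "j \<in> J \<Longrightarrow> x \<in> \<Omega> \<Longrightarrow> j (j x) = x"
  by (simp only: involution_iff)

lemma involution_moves_point:
  assumes "j \<in> J"
  obtains x where "x \<in> \<Omega>" "j x \<noteq> x"
  using assms by (auto simp only: involution_iff)

lemma involution_at_most_one_fixpoint: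
  assumes "j \<in> J" "x \<in> \<Omega>" "y \<in> \<Omega>" "j x = x" "j y = y"
  shows "x = y"
  using id_if_two_fixpoints[of j x y] involution_moves_point[OF assms(1)] assms
  by (metis involution_in)

lemma involution_eqI:
  assumes "i \<in> J" "j \<in> J" "x \<in> \<Omega>" "i x = j x" "i x \<noteq> x"
  shows "i = j"
proof (rule eqI_two_points)
  show "i (i x) = j (i x)"
    using assms by (metis involution_involutory)
qed (use assms in auto)

text \<open>
  Exchanging two points is one of the prescriptions that 2-transitivity can meet, and the square of
  an element that exchanges them fixes both. So involutions always exist.
\<close>

lemma swapping_involution:
  assumes "x \<in> \<Omega>" "y \<in> \<Omega>" "x \<noteq> y"
  obtains j where "j \<in> J" "j x = y" "j y = x"
proof -
  obtain j where j: "j \<in> G" "j x = y" "j y = x"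
    using transport[of x y y x] assms by metis
  have "j (j z) = z" if "z \<in> \<Omega>" for z
    unfolding compose_eq[OF that, where g = j and f = j, symmetric]
    by (rule id_if_two_fixpoints[OF compose_closed[OF j(1) j(1)] assms])
       (use that j assms in \<open>auto simp: compose_eq\<close>)
  then have "j \<in> J"
    using involutionI[of j x] j assms by simp
  with j that show thesis by blast
qed

lemma conjugate_involution:
  assumes "i \<in> J" "g \<in> G"
  obtains j where "j \<in> J" "\<And>x. x \<in> \<Omega> \<Longrightarrow> j (g x) = g (i x)"
proof -
  obtain h where h: "h \<in> G" "\<And>x. x \<in> \<Omega> \<Longrightarrow> h (g x) = x" "\<And>x. x \<in> \<Omega> \<Longrightarrow> g (h x) = x"
    using inverse[OF assms(2)] by blast
  let ?j = "compose \<Omega> g (compose \<Omega> i h)"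
  have "?j \<in> G"
    using assms h by (simp add: compose_closed)
  moreover have conj: "?j (g x) = g (i x)" if "x \<in> \<Omega>" for x
    using that assms h by (simp add: compose_eq)
  moreover have "?j (?j x) = x" if "x \<in> \<Omega>" for x
    using that assms h by (simp add: compose_eq)
  moreover obtain x where "x \<in> \<Omega>" "i x \<noteq> x"
    using involution_moves_point[OF assms(1)] by blast
  then have "?j (g x) \<noteq> g x" "g x \<in> \<Omega>"
    using conj assms by auto
  ultimately have "?j \<in> J"
    using involutionI by metis
  with conj that show thesis by blast
qed

text \<open>
  An involution is determined by any pair of points that it swaps, and all such pairs are
  equivalent under the group.
\<close>

lemma involutions_conjugate:
  assumes "i \<in> J" "j \<in> J"
  obtains g where "g \<in> G" "\<And>x. x \<in> \<Omega> \<Longrightarrow> g (i x) = j (g x)"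
proof -
  obtain x y where x: "x \<in> \<Omega>" "i x \<noteq> x" and y: "y \<in> \<Omega>" "j y \<noteq> y"
    using involution_moves_point assms by metis
  obtain g where g: "g \<in> G" "g x = y" "g (i x) = j y"
    using transport[of x "i x" y "j y"] assms x y by (metis closed involution_in)
  obtain k where k: "k \<in> J" "\<And>z. z \<in> \<Omega> \<Longrightarrow> k (g z) = g (i z)"
    using conjugate_involution[OF assms(1) g(1)] by blast
  have "k = j"
    by (rule involution_eqI[of k j y]) (use k g x y assms in \<open>metis\<close>)+
  with k g that show thesis by metis
qed

lemma char_2_if_fixpoint_free:
  assumes "i \<in> J" "\<And>x. x \<in> \<Omega> \<Longrightarrow> i x \<noteq> x"
  shows "char_2 G \<Omega>"
  unfolding char_2_def
proof (intro ballI)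
  fix j x assume "j \<in> J" "x \<in> \<Omega>"
  obtain g where g: "g \<in> G" "\<And>x. x \<in> \<Omega> \<Longrightarrow> g (j x) = i (g x)"
    using involutions_conjugate[OF \<open>j \<in> J\<close> assms(1)] by blast
  have "i (g x) \<noteq> g x"
    using assms(2) g \<open>x \<in> \<Omega>\<close> by simp
  then show "j x \<noteq> x"
    using g(2)[OF \<open>x \<in> \<Omega>\<close>] by auto
qed

lemma involution_fixing:
  assumes "\<not> char_2 G \<Omega>" "x \<in> \<Omega>"
  obtains j where "j \<in> J" "j x = x"
proof -
  obtain i y where i: "i \<in> J" "y \<in> \<Omega>" "i y = y"
    using assms(1) by (auto simp: char_2_def)
  obtain g where g: "g \<in> G" "g y = x"
  proof (cases "x = y")
    case True
    then show ?thesis using that[OF id_closed] i by simp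
  next
    case False
    then show ?thesis
      using swapping_involution[of y x] that assms i by (metis involution_in)
  qed
  obtain j where "j \<in> J" "\<And>z. z \<in> \<Omega> \<Longrightarrow> j (g z) = g (i z)"
    using conjugate_involution[OF i(1) g(1)] by blast
  with i g that show thesis by metis
qed

text \<open>
  This is the key to the regularity of the translations. Fix a point \<open>x\<close> other than the fixpoint \<open>q\<close>. Sending \<open>p\<close> to the fixpoint of the involution that
  swaps \<open>x\<close> and \<open>p\<close> commutes with the stabilizer of \<open>x\<close>, which acts regularly on the other
  points; hence this map (halving, if \<open>x\<close> is regarded as zero) is injective.
\<close>

lemma involution_fixing_unique:
  assumes "i \<in> J" "j \<in> J" "q \<in> \<Omega>" "i q = q" "j q = q"
  shows "i = j"
proof -
  obtain x where x: "x \<in> \<Omega>" "x \<noteq> q"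
    using exists_two_points by metis
  have moved: "i x \<noteq> x" "j x \<noteq> x"
    using involution_at_most_one_fixpoint x assms by metis+
  obtain g where g: "g \<in> G" "g x = x" "g (i x) = j x"
    using transport[of x "i x" x "j x"] x moved assms by (metis closed involution_in)
  obtain k where k: "k \<in> J" "\<And>z. z \<in> \<Omega> \<Longrightarrow> k (g z) = g (i z)"
    using conjugate_involution[OF assms(1) g(1)] by blast
  have "k = j"
    by (rule involution_eqI[of k j x]) (use k g x moved assms in \<open>metis\<close>)+
  then have "j (g q) = g q"
    using k assms by metis
  then have "g q = q"
    using involution_at_most_one_fixpoint[of j "g q" q] assms g by simp
  then have "g (i x) = i x"
    using id_if_two_fixpoints[OF g(1) x(1) assms(3)] x g assms by simp
  then have "i x = j x"
    by (simp only: g)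
  then show ?thesis
    by (rule involution_eqI[OF assms(1,2) x(1) _ moved(1)])
qed

context
  fixes z\<^sub>0 :: 'a
  assumes base: "z\<^sub>0 \<in> \<Omega>"
begin

abbreviation A where "A \<equiv> regular_set G \<Omega> z\<^sub>0"
abbreviation \<nu> where "\<nu> \<equiv> base_involution G \<Omega> z\<^sub>0"

lemma base_involution_eqI:
  assumes "j \<in> J" "j z\<^sub>0 = z\<^sub>0"
  shows "\<nu> = j"
  unfolding base_involution_def
  by (rule the_equality) (use assms base involution_fixing_unique in \<open>blast\<close>)+

lemma base_involution:
  assumes "\<not> char_2 G \<Omega>"
  shows "\<nu> \<in> J" "\<nu> z\<^sub>0 = z\<^sub>0"
  using involution_fixing[OF assms base] base_involution_eqI by metis+

lemma in_regular_set_char_2: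
  assumes "char_2 G \<Omega>"
  shows "a \<in> A \<longleftrightarrow> a \<in> J \<or> a = (\<lambda>x\<in>\<Omega>. x)"
  using assms by (auto simp: regular_set_def)

lemma in_regular_set_not_char_2:
  assumes "\<not> char_2 G \<Omega>" "a \<in> extensional \<Omega>"
  shows "a \<in> A \<longleftrightarrow> (\<exists>j\<in>J. \<forall>x\<in>\<Omega>. a x = j (\<nu> x))"
proof -
  have "a = compose \<Omega> j \<nu> \<longleftrightarrow> (\<forall>x\<in>\<Omega>. a x = j (\<nu> x))" for j
    using assms(2) by (auto simp: fun_eq_iff compose_def extensional_def)
  then show ?thesis
    using assms(1) by (auto simp: regular_set_def)
qed

lemma regular_set_subset: "a \<in> A \<Longrightarrow> a \<in> G"
  using base_involution
  by (auto simp: regular_set_def id_closed intro: compose_closed split: if_splits)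

lemma regular_setE:
  assumes "\<not> char_2 G \<Omega>" "a \<in> A"
  obtains j where "j \<in> J" "\<And>x. x \<in> \<Omega> \<Longrightarrow> a x = j (\<nu> x)"
  using in_regular_set_not_char_2[OF assms(1) extensional[OF regular_set_subset]] assms by blast

lemma regular_setI:
  assumes "\<not> char_2 G \<Omega>" "a \<in> G" "j \<in> J" "\<And>x. x \<in> \<Omega> \<Longrightarrow> a x = j (\<nu> x)"
  shows "a \<in> A"
  using in_regular_set_not_char_2[OF assms(1) extensional[OF assms(2)]] assms by blast

lemma id_in_regular_set: "(\<lambda>x\<in>\<Omega>. x) \<in> A"
proof (cases "char_2 G \<Omega>")
  case False
  show ?thesis
    by (rule regular_setI[OF False id_closed base_involution(1)[OF False]])
       (simp add: base_involution[OF False])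
qed (simp add: in_regular_set_char_2)

text \<open>
  In characteristic other than 2 the factor \<open>\<nu>\<close> is a permutation, so it suffices that exactly one
  involution takes a given point \<open>p\<close> to a given point \<open>q\<close>. For \<open>p \<noteq> q\<close> this is the involution that
  exchanges them; for \<open>p = q\<close> it is the involution that fixes \<open>p\<close>.
\<close>

lemma regular_set_transitive:
  assumes "x \<in> \<Omega>" "y \<in> \<Omega>"
  obtains a where "a \<in> A" "a x = y"
proof (cases "char_2 G \<Omega>")
  case True
  then show ?thesis
    using that in_regular_set_char_2[OF True] swapping_involution[OF assms] assms
    by (metis restrict_apply')
next
  case False
  note \<nu> = base_involution[OF False]
  obtain j where j: "j \<in> J" "j (\<nu> x) = y"
    using involution_fixing[OF False assms(2)] swapping_involution[of "\<nu> x" y] assms \<nu>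
    by (metis closed involution_in)
  show ?thesis
  proof
    show "compose \<Omega> j \<nu> \<in> A"
      by (rule regular_setI[OF False _ j(1)]) (use j \<nu> in \<open>auto simp: compose_closed compose_eq\<close>)
    show "compose \<Omega> j \<nu> x = y"
      using j assms by (simp add: compose_eq)
  qed
qed

lemma regular_set_unique:
  assumes "a \<in> A" "b \<in> A" "x \<in> \<Omega>" "a x = b x"
  shows "a = b"
proof (cases "char_2 G \<Omega>")
  case True
  have fixpoint_free: "j x \<noteq> x" if "j \<in> J" for j
    using True that assms by (simp add: char_2_def)
  show ?thesis
    using assms in_regular_set_char_2[OF True] involution_eqI[of a b x] fixpoint_free
    by (metis restrict_apply')
next
  case False
  note \<nu> = base_involution[OF False]
  obtain i where i: "i \<in> J" "\<And>x. x \<in> \<Omega> \<Longrightarrow> a x = i (\<nu> x)"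
    using regular_setE[OF False assms(1)] by blast
  obtain j where j: "j \<in> J" "\<And>x. x \<in> \<Omega> \<Longrightarrow> b x = j (\<nu> x)"
    using regular_setE[OF False assms(2)] by blast
  have "i (\<nu> x) = j (\<nu> x)" "\<nu> x \<in> \<Omega>"
    using i j assms \<nu> by auto
  then have "i = j"
    using involution_eqI[OF i(1) j(1)] involution_fixing_unique[OF i(1) j(1)] by metis
  then show ?thesis
    using eqI_pointwise regular_set_subset assms(1,2) i j by metis
qed

text \<open>
  Closure under inverses is what makes the additive inverses of \<open>K G\<close> two-sided.
\<close>

lemma regular_set_inverse:
  assumes "a \<in> A"
  obtains b where "b \<in> A" "\<And>x. x \<in> \<Omega> \<Longrightarrow> b (a x) = x"
proof (cases "char_2 G \<Omega>")
  case True
  then have "a (a x) = x" if "x \<in> \<Omega>" for x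
    using assms that in_regular_set_char_2[OF True] by auto
  with that assms show ?thesis by blast
next
  case False
  note \<nu> = base_involution[OF False]
  obtain j where j: "j \<in> J" "\<And>x. x \<in> \<Omega> \<Longrightarrow> a x = j (\<nu> x)"
    using regular_setE[OF False assms(1)] by blast
  \<comment> \<open>The inverse of \<open>j \<nu>\<close> is \<open>\<nu> j = (\<nu> j \<nu>) \<nu>\<close>.\<close>
  obtain k where k: "k \<in> J" "\<And>x. x \<in> \<Omega> \<Longrightarrow> k (\<nu> x) = \<nu> (j x)"
    using conjugate_involution[OF j(1)] \<nu> involution_in by metis
  show ?thesis
  proof
    show "compose \<Omega> k \<nu> \<in> A"
      by (rule regular_setI[OF False _ k(1)]) (use k \<nu> in \<open>auto simp: compose_closed compose_eq\<close>)
    show "compose \<Omega> k \<nu> (a x) = x" if "x \<in> \<Omega>" for x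
      using that j k \<nu> by (simp add: compose_eq)
  qed
qed

text \<open>
  This becomes the distributive law: the stabilizer of the base point normalizes the set of involutions and centralizes the only
  involution that fixes the base point.
\<close>

lemma regular_set_normalized:
  assumes "a \<in> A" "g \<in> G" "g z\<^sub>0 = z\<^sub>0"
  obtains b where "b \<in> A" "\<And>x. x \<in> \<Omega> \<Longrightarrow> b (g x) = g (a x)"
proof (cases "char_2 G \<Omega>")
  case True
  show ?thesis
  proof (cases "a \<in> J")
    case True
    with conjugate_involution[OF this assms(2)] that in_regular_set_char_2[OF \<open>char_2 G \<Omega>\<close>]
    show ?thesis by metis
  next
    case False
    then have "a = (\<lambda>x\<in>\<Omega>. x)"
      using assms in_regular_set_char_2[OF \<open>char_2 G \<Omega>\<close>] by blast
    with that[OF id_in_regular_set] show ?thesis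
      using assms by simp
  qed
next
  case False
  note \<nu> = base_involution[OF False]
  obtain j where j: "j \<in> J" "\<And>x. x \<in> \<Omega> \<Longrightarrow> a x = j (\<nu> x)"
    using regular_setE[OF False assms(1)] by blast
  obtain k where k: "k \<in> J" "\<And>x. x \<in> \<Omega> \<Longrightarrow> k (g x) = g (j x)"
    using conjugate_involution[OF j(1) assms(2)] by blast
  obtain \<mu> where \<mu>: "\<mu> \<in> J" "\<And>x. x \<in> \<Omega> \<Longrightarrow> \<mu> (g x) = g (\<nu> x)"
    using conjugate_involution[OF \<nu>(1) assms(2)] by blast
  have "\<mu> z\<^sub>0 = z\<^sub>0"
    using \<mu>(2)[OF base] assms \<nu> by simp
  then have "\<mu> = \<nu>"
    using \<mu> base_involution_eqI by metis
  show ?thesis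
  proof
    show "compose \<Omega> k \<nu> \<in> A"
      by (rule regular_setI[OF False _ k(1)]) (use k \<nu> in \<open>auto simp: compose_closed compose_eq\<close>)
    show "compose \<Omega> k \<nu> (g x) = g (a x)" if "x \<in> \<Omega>" for x
      using that j k \<nu> \<mu> \<open>\<mu> = \<nu>\<close> assms by (simp add: compose_eq)
  qed
qed

end

end


section \<open>The neardomain of a sharply 2-transitive group\<close>

locale s2t_object =
  fixes X :: "'a s2t"
  assumes object: "is_s2t X"
begin

sublocale sharply_2_transitive_group "grp X" "pts X"
  using object by unfold_locales (simp add: is_s2t_def)

lemma base [simp]: "base0 X \<in> pts X" "base1 X \<in> pts X" "base0 X \<noteq> base1 X" "base1 X \<noteq> base0 X"
  using object by (auto simp: is_s2t_def)

abbreviation translation_set where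
  "translation_set \<equiv> regular_set (grp X) (pts X) (base0 X)"

lemma eqI_base:
  assumes "g \<in> grp X" "h \<in> grp X" "g (base0 X) = h (base0 X)" "g (base1 X) = h (base1 X)"
  shows "g = h"
  using eqI_two_points[of g h "base0 X" "base1 X"] assms by simp

text \<open>
  The partially applied sum \<open>s2t_add X \<alpha>\<close> is itself an element of the group, so additive identities
  can be proved by identifying group elements.
\<close>

lemma add_eqI:
  assumes "a \<in> translation_set" "a (base0 X) = \<alpha>"
  shows "s2t_add X \<alpha> = a"
proof -
  have "(THE a. a \<in> translation_set \<and> a (base0 X) = \<alpha>) = a"
    by (rule the_equality) (use assms regular_set_unique[OF base(1) _ _ base(1)] in metis)+
  then show ?thesis
    by (simp add: fun_eq_iff s2t_add_def)
qed

lemma add_translation: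
  assumes "\<alpha> \<in> pts X"
  shows "s2t_add X \<alpha> \<in> translation_set" "s2t_add X \<alpha> (base0 X) = \<alpha>"
  using regular_set_transitive[OF base(1) base(1) assms] add_eqI by metis+

lemma add_in_group [simp]: "\<alpha> \<in> pts X \<Longrightarrow> s2t_add X \<alpha> \<in> grp X"
  using add_translation regular_set_subset[OF base(1)] by blast

lemma add_closed [simp]: "\<alpha> \<in> pts X \<Longrightarrow> \<beta> \<in> pts X \<Longrightarrow> s2t_add X \<alpha> \<beta> \<in> pts X"
  by simp

lemma add_base0 [simp]: "\<alpha> \<in> pts X \<Longrightarrow> s2t_add X \<alpha> (base0 X) = \<alpha>"
  by (rule add_translation)

lemma base0_add [simp]: "\<alpha> \<in> pts X \<Longrightarrow> s2t_add X (base0 X) \<alpha> = \<alpha>"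
  using add_eqI[OF id_in_regular_set[OF base(1)]] by simp

lemma add_left_solvable:
  assumes "\<alpha> \<in> pts X" "\<beta> \<in> pts X"
  shows "\<exists>!x. x \<in> pts X \<and> s2t_add X \<alpha> x = \<beta>"
proof -
  obtain h where "h \<in> grp X" "\<And>x. x \<in> pts X \<Longrightarrow> s2t_add X \<alpha> (h x) = x"
    using inverse[OF add_in_group[OF assms(1)]] by metis
  then have "h \<beta> \<in> pts X \<and> s2t_add X \<alpha> (h \<beta>) = \<beta>"
    using assms by simp
  then show ?thesis
    using inj_iff[OF add_in_group[OF assms(1)]] by metis
qed

lemma add_right_solvable:
  assumes "\<alpha> \<in> pts X" "\<beta> \<in> pts X"
  shows "\<exists>!y. y \<in> pts X \<and> s2t_add X y \<alpha> = \<beta>"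
proof -
  obtain a where a: "a \<in> translation_set" "a \<alpha> = \<beta>"
    using regular_set_transitive[OF base(1) assms] by blast
  have "a (base0 X) \<in> pts X \<and> s2t_add X (a (base0 X)) \<alpha> = \<beta>"
    using add_eqI[OF a(1) refl] a regular_set_subset[OF base(1)] by simp
  moreover have "y = a (base0 X)" if "y \<in> pts X" "s2t_add X y \<alpha> = \<beta>" for y
    using regular_set_unique[OF base(1) add_translation(1)[OF that(1)] a(1) assms(1)] a that
    by (metis add_base0)
  ultimately show ?thesis by blast
qed

lemma add_inverse_commute:
  assumes "\<alpha> \<in> pts X" "\<beta> \<in> pts X" "s2t_add X \<alpha> \<beta> = base0 X"
  shows "s2t_add X \<beta> \<alpha> = base0 X"
proof -
  obtain b where b: "b \<in> translation_set" "\<And>x. x \<in> pts X \<Longrightarrow> b (s2t_add X \<alpha> x) = x"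
    using regular_set_inverse[OF base(1) add_translation(1)[OF assms(1)]] by blast
  have "b (base0 X) = \<beta>"
    using b(2)[OF assms(2)] assms(3) by simp
  then show ?thesis
    using add_eqI[OF b(1)] b(2)[OF base(1)] assms by simp
qed

lemma mult_eqI:
  assumes "g \<in> grp X" "g (base0 X) = base0 X" "g (base1 X) = \<alpha>" "\<beta> \<in> pts X"
  shows "s2t_mult X \<alpha> \<beta> = g \<beta>"
proof -
  have "(THE g. g \<in> grp X \<and> g (base0 X) = base0 X \<and> g (base1 X) = \<alpha>) = g"
    by (rule the_equality) (use assms eqI_base in metis)+
  moreover have "\<alpha> \<noteq> base0 X"
    using assms inj_iff[of g "base0 X" "base1 X"] by simp
  ultimately show ?thesis
    using assms by (auto simp: s2t_mult_def)
qed

lemma scaling: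
  assumes "\<alpha> \<in> pts X" "\<alpha> \<noteq> base0 X"
  obtains g where "g \<in> grp X" "g (base0 X) = base0 X" "g (base1 X) = \<alpha>"
    "\<And>\<beta>. \<beta> \<in> pts X \<Longrightarrow> s2t_mult X \<alpha> \<beta> = g \<beta>"
  using transport[of "base0 X" "base1 X" "base0 X" \<alpha>] assms mult_eqI by (metis base)

lemma base0_mult [simp]: "s2t_mult X (base0 X) \<alpha> = base0 X" "s2t_mult X \<alpha> (base0 X) = base0 X"
  by (simp_all add: s2t_mult_def)

lemma base1_mult [simp]:
  assumes "\<alpha> \<in> pts X"
  shows "s2t_mult X (base1 X) \<alpha> = \<alpha>" "s2t_mult X \<alpha> (base1 X) = \<alpha>"
proof -
  show "s2t_mult X (base1 X) \<alpha> = \<alpha>"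
    using mult_eqI[OF id_closed _ _ assms] assms by simp
  show "s2t_mult X \<alpha> (base1 X) = \<alpha>"
    using scaling[OF assms] base(2) base0_mult(1) by metis
qed

lemma mult_closed [simp]:
  assumes "\<alpha> \<in> pts X" "\<beta> \<in> pts X"
  shows "s2t_mult X \<alpha> \<beta> \<in> pts X"
  using scaling[OF assms(1)] assms(2) base(1) closed base0_mult(1) by metis

lemma mult_nonzero:
  assumes "\<alpha> \<in> pts X" "\<beta> \<in> pts X" "\<alpha> \<noteq> base0 X" "\<beta> \<noteq> base0 X"
  shows "s2t_mult X \<alpha> \<beta> \<noteq> base0 X"
  using scaling[OF assms(1,3)] assms by (metis base(1) inj_iff)

lemma mult_assoc:
  assumes "\<alpha> \<in> pts X" "\<beta> \<in> pts X" "\<gamma> \<in> pts X"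
  shows "s2t_mult X (s2t_mult X \<alpha> \<beta>) \<gamma> = s2t_mult X \<alpha> (s2t_mult X \<beta> \<gamma>)"
proof (cases "\<alpha> = base0 X \<or> \<beta> = base0 X")
  case False
  obtain g where g: "g \<in> grp X" "g (base0 X) = base0 X" "g (base1 X) = \<alpha>"
      "\<And>\<beta>. \<beta> \<in> pts X \<Longrightarrow> s2t_mult X \<alpha> \<beta> = g \<beta>"
    using scaling assms False by metis
  obtain h where h: "h \<in> grp X" "h (base0 X) = base0 X" "h (base1 X) = \<beta>"
      "\<And>\<gamma>. \<gamma> \<in> pts X \<Longrightarrow> s2t_mult X \<beta> \<gamma> = h \<gamma>"
    using scaling assms False by metis
  have "s2t_mult X (g \<beta>) \<gamma> = compose (pts X) g h \<gamma>"
    by (rule mult_eqI) (use g h assms in \<open>simp_all add: compose_closed compose_eq\<close>)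
  then show ?thesis
    using g h assms by (simp add: compose_eq)
qed auto

lemma mult_inverse:
  assumes "\<alpha> \<in> pts X" "\<alpha> \<noteq> base0 X"
  shows "\<exists>\<beta>\<in>pts X - {base0 X}. s2t_mult X \<beta> \<alpha> = base1 X"
proof -
  obtain g where g: "g \<in> grp X" "g (base0 X) = base0 X" "g (base1 X) = \<alpha>"
      "\<And>\<beta>. \<beta> \<in> pts X \<Longrightarrow> s2t_mult X \<alpha> \<beta> = g \<beta>"
    using scaling assms by metis
  obtain h where h: "h \<in> grp X" "\<And>x. x \<in> pts X \<Longrightarrow> h (g x) = x"
    using inverse[OF g(1)] by metis
  have h0: "h (base0 X) = base0 X"
    using h(2)[OF base(1)] g by simp
  have "s2t_mult X (h (base1 X)) \<alpha> = h \<alpha>"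
    by (rule mult_eqI) (use h h0 assms in simp_all)
  moreover have "h \<alpha> = base1 X"
    using h(2)[OF base(2)] g by simp
  moreover have "h (base1 X) \<noteq> base0 X"
    using inj_iff[OF h(1), of "base1 X" "base0 X"] h0 by simp
  ultimately show ?thesis
    using h(1) by force
qed

lemma distrib:
  assumes "\<alpha> \<in> pts X" "\<beta> \<in> pts X" "\<gamma> \<in> pts X"
  shows "s2t_mult X \<alpha> (s2t_add X \<beta> \<gamma>) = s2t_add X (s2t_mult X \<alpha> \<beta>) (s2t_mult X \<alpha> \<gamma>)"
proof (cases "\<alpha> = base0 X")
  case False
  obtain g where g: "g \<in> grp X" "g (base0 X) = base0 X" "g (base1 X) = \<alpha>"
      "\<And>\<beta>. \<beta> \<in> pts X \<Longrightarrow> s2t_mult X \<alpha> \<beta> = g \<beta>"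
    using scaling assms False by metis
  obtain b where b: "b \<in> translation_set" "\<And>x. x \<in> pts X \<Longrightarrow> b (g x) = g (s2t_add X \<beta> x)"
    using regular_set_normalized[OF base(1) add_translation(1)[OF assms(2)] g(1,2)] by blast
  have "b (base0 X) = g \<beta>"
    using b(2)[OF base(1)] g assms by simp
  then have "s2t_add X (g \<beta>) = b"
    by (rule add_eqI[OF b(1)])
  then show ?thesis
    using g b assms by simp
qed auto

text \<open>
  The composite of two translations differs from a translation by an element of the stabilizer of
  the base point, that is, by a multiplication.
\<close>

lemma add_assoc_up_to_scaling:
  assumes "\<alpha> \<in> pts X" "\<beta> \<in> pts X"
  shows "\<exists>\<delta>\<in>pts X - {base0 X}. \<forall>x\<in>pts X.
    s2t_add X \<alpha> (s2t_add X \<beta> x) = s2t_add X (s2t_add X \<alpha> \<beta>) (s2t_mult X \<delta> x)"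
proof -
  obtain h where h: "h \<in> grp X" "\<And>x. x \<in> pts X \<Longrightarrow> h (s2t_add X (s2t_add X \<alpha> \<beta>) x) = x"
      "\<And>x. x \<in> pts X \<Longrightarrow> s2t_add X (s2t_add X \<alpha> \<beta>) (h x) = x"
    using inverse[of "s2t_add X (s2t_add X \<alpha> \<beta>)"] assms by (metis add_closed add_in_group)
  let ?g = "compose (pts X) h (compose (pts X) (s2t_add X \<alpha>) (s2t_add X \<beta>))"
  have g: "?g \<in> grp X"
    using h assms by (simp add: compose_closed)
  have g_eq: "?g x = h (s2t_add X \<alpha> (s2t_add X \<beta> x))" if "x \<in> pts X" for x
    using that by (simp add: compose_eq)
  have g0: "?g (base0 X) = base0 X"
    using h(2)[OF base(1)] assms by (simp add: g_eq)
  have scale: "s2t_mult X (?g (base1 X)) x = ?g x" if "x \<in> pts X" for x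
    by (rule mult_eqI[OF g g0 refl that])
  have "s2t_add X \<alpha> (s2t_add X \<beta> x) =
      s2t_add X (s2t_add X \<alpha> \<beta>) (s2t_mult X (?g (base1 X)) x)" if "x \<in> pts X" for x
    using that h assms by (simp add: scale) (simp add: g_eq)
  moreover have "?g (base1 X) \<in> pts X - {base0 X}"
    using inj_iff[OF g base(2,1)] g0 closed[OF g base(2)] by simp
  ultimately show ?thesis by blast
qed

lemma neardomain: "is_neardomain (on_obj functor_K X)"
proof -
  have "group \<lparr>carrier = pts X - {base0 X}, mult = s2t_mult X, one = base1 X\<rparr>"
    by (rule groupI) (auto simp: mult_nonzero mult_assoc mult_inverse)
  then show ?thesis
    using add_left_solvable add_right_solvable add_inverse_commute distrib
      add_assoc_up_to_scaling
    by (simp add: is_neardomain_def is_loop_def functor_K_def)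
qed

end

section \<open>The affine group of a neardomain\<close>

definition affine :: "'a ring \<Rightarrow> 'a \<Rightarrow> 'a \<Rightarrow> 'a \<Rightarrow> 'a" where
  "affine F a m = (\<lambda>x\<in>carrier F. a \<oplus>\<^bsub>F\<^esub> (m \<otimes>\<^bsub>F\<^esub> x))"

text \<open>
  Every element of the affine group has a unique presentation \<open>affine F a m\<close>: it sends \<open>0\<close> to \<open>a\<close>
  and \<open>1\<close> to \<open>a + m\<close>.
\<close>

definition affine_s2t :: "'a ring \<Rightarrow> 'a s2t" where
  "affine_s2t F =
    \<lparr>grp = {affine F a m | a m. a \<in> carrier F \<and> m \<in> carrier F - {\<zero>\<^bsub>F\<^esub>}},
     pts = carrier F, base0 = \<zero>\<^bsub>F\<^esub>, base1 = \<one>\<^bsub>F\<^esub>\<rparr>"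

locale neardomain =
  fixes F :: "'a ring" (structure)
  assumes neardomain: "is_neardomain F"
begin

abbreviation C where "C \<equiv> carrier F"

lemma mult_group: "group \<lparr>carrier = C - {\<zero>}, mult = mult F, one = \<one>\<rparr>"
  using neardomain by (simp add: is_neardomain_def)

lemma closed [simp]:
  "\<zero> \<in> C" "\<one> \<in> C" "a \<in> C \<Longrightarrow> b \<in> C \<Longrightarrow> a \<oplus> b \<in> C" "a \<in> C \<Longrightarrow> b \<in> C \<Longrightarrow> a \<otimes> b \<in> C"
  using neardomain group.is_monoid[OF mult_group, THEN monoid.one_closed]
  by (auto simp: is_neardomain_def is_loop_def)

lemma one_neq_zero [simp]: "\<one> \<noteq> \<zero>" "\<zero> \<noteq> \<one>"
  using group.is_monoid[OF mult_group, THEN monoid.one_closed] by auto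

lemma zero_add [simp]: "a \<in> C \<Longrightarrow> \<zero> \<oplus> a = a" "a \<in> C \<Longrightarrow> a \<oplus> \<zero> = a"
  using neardomain by (simp_all add: is_neardomain_def is_loop_def)

lemma add_left_solve:
  assumes "a \<in> C" "b \<in> C"
  obtains x where "x \<in> C" "a \<oplus> x = b"
proof -
  have "\<exists>!x. x \<in> C \<and> a \<oplus> x = b"
    using neardomain assms by (simp add: is_neardomain_def is_loop_def)
  with that show thesis by blast
qed

lemma add_left_cancel [simp]:
  assumes "a \<in> C" "x \<in> C" "y \<in> C"
  shows "a \<oplus> x = a \<oplus> y \<longleftrightarrow> x = y"
proof -
  have "\<exists>!z. z \<in> C \<and> a \<oplus> z = a \<oplus> x"
    using neardomain assms by (simp add: is_neardomain_def is_loop_def)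
  with assms show ?thesis by metis
qed

lemma add_right_cancel [simp]:
  assumes "a \<in> C" "x \<in> C" "y \<in> C"
  shows "x \<oplus> a = y \<oplus> a \<longleftrightarrow> x = y"
proof -
  have "\<exists>!z. z \<in> C \<and> z \<oplus> a = x \<oplus> a"
    using neardomain assms by (simp add: is_neardomain_def is_loop_def)
  with assms show ?thesis by metis
qed

lemma add_inverse_commute: "a \<in> C \<Longrightarrow> b \<in> C \<Longrightarrow> a \<oplus> b = \<zero> \<Longrightarrow> b \<oplus> a = \<zero>"
  using neardomain by (simp add: is_neardomain_def)

lemma distrib: "a \<in> C \<Longrightarrow> b \<in> C \<Longrightarrow> c \<in> C \<Longrightarrow> a \<otimes> (b \<oplus> c) = (a \<otimes> b) \<oplus> (a \<otimes> c)"
  using neardomain by (simp add: is_neardomain_def)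

lemma add_assoc_up_to_scaling:
  assumes "a \<in> C" "b \<in> C"
  obtains d where "d \<in> C" "d \<noteq> \<zero>" "\<And>x. x \<in> C \<Longrightarrow> a \<oplus> (b \<oplus> x) = (a \<oplus> b) \<oplus> (d \<otimes> x)"
  using neardomain assms unfolding is_neardomain_def by blast

lemma zero_mult [simp]: "a \<in> C \<Longrightarrow> \<zero> \<otimes> a = \<zero>"
  using neardomain by (simp add: is_neardomain_def)

lemma mult_zero [simp]:
  assumes "a \<in> C"
  shows "a \<otimes> \<zero> = \<zero>"
proof -
  have "a \<otimes> \<zero> \<oplus> a \<otimes> \<zero> = a \<otimes> \<zero> \<oplus> \<zero>"
    using distrib[of a \<zero> \<zero>] assms by simp
  then show ?thesis
    using assms by (simp only: add_left_cancel closed)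
qed

lemma mult_one [simp]: "a \<in> C \<Longrightarrow> a \<otimes> \<one> = a" "a \<in> C \<Longrightarrow> \<one> \<otimes> a = a"
  using group.is_monoid[OF mult_group, THEN monoid.r_one, of a]
    group.is_monoid[OF mult_group, THEN monoid.l_one, of a]
  by (cases "a = \<zero>"; simp)+

lemma mult_nonzero [simp]:
  "a \<in> C \<Longrightarrow> b \<in> C \<Longrightarrow> a \<noteq> \<zero> \<Longrightarrow> b \<noteq> \<zero> \<Longrightarrow> a \<otimes> b \<noteq> \<zero>"
  using group.is_monoid[OF mult_group, THEN monoid.m_closed, of a b] by simp

lemma mult_assoc:
  "a \<in> C \<Longrightarrow> b \<in> C \<Longrightarrow> c \<in> C \<Longrightarrow> (a \<otimes> b) \<otimes> c = a \<otimes> (b \<otimes> c)"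
  using group.is_monoid[OF mult_group, THEN monoid.m_assoc, of a b c]
  by (cases "a = \<zero> \<or> b = \<zero> \<or> c = \<zero>") auto

lemma mult_inverse:
  assumes "a \<in> C" "a \<noteq> \<zero>"
  obtains b where "b \<in> C" "b \<noteq> \<zero>" "b \<otimes> a = \<one>" "a \<otimes> b = \<one>"
  using group.l_inv[OF mult_group, of a] group.r_inv[OF mult_group, of a]
    group.inv_closed[OF mult_group, of a] assms by auto

lemma mult_left_cancel [simp]:
  assumes "a \<in> C" "a \<noteq> \<zero>" "x \<in> C" "y \<in> C"
  shows "a \<otimes> x = a \<otimes> y \<longleftrightarrow> x = y"
  using mult_inverse[OF assms(1,2)] assms mult_assoc by (metis mult_one(2))

text \<open>
  The scaling factor \<open>d\<close> that belongs to \<open>a\<close> and its additive inverse \<open>b\<close> is \<open>1\<close>: putting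
  \<open>x = a\<close> in \<open>a + (b + x) = d x\<close> gives \<open>a = d a\<close>, because \<open>b + a = 0\<close>.
\<close>

lemma add_inverse_cancel:
  assumes "a \<in> C" "b \<in> C" "a \<oplus> b = \<zero>" "x \<in> C"
  shows "a \<oplus> (b \<oplus> x) = x"
proof (cases "a = \<zero>")
  case True
  with assms show ?thesis by simp
next
  case False
  obtain d where d: "d \<in> C" "d \<noteq> \<zero>" "\<And>x. x \<in> C \<Longrightarrow> a \<oplus> (b \<oplus> x) = (a \<oplus> b) \<oplus> (d \<otimes> x)"
    using add_assoc_up_to_scaling[OF assms(1,2)] by blast
  have "a = d \<otimes> a"
    using d(3)[OF assms(1)] add_inverse_commute[OF assms(1-3)] assms d(1) by simp
  moreover obtain c where c: "c \<in> C" "a \<otimes> c = \<one>"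
    using mult_inverse[OF assms(1) False] by blast
  ultimately have "d = \<one>"
    using mult_assoc[OF d(1) assms(1) c(1)] d(1) by simp
  then show ?thesis
    using d(3)[OF assms(4)] assms by simp
qed

text \<open>
  Here \<open>e\<close> is the additive inverse of \<open>1\<close>. Left distributivity makes \<open>a e\<close> the additive inverse of
  \<open>a\<close>, and then \<open>e e\<close> is the additive inverse of \<open>e\<close>, which is \<open>1\<close>.
\<close>

lemma minus_one:
  obtains e where "e \<in> C" "e \<noteq> \<zero>" "e \<otimes> e = \<one>" "\<And>a. a \<in> C \<Longrightarrow> a \<oplus> a \<otimes> e = \<zero>"
proof -
  obtain e where e: "e \<in> C" "\<one> \<oplus> e = \<zero>"
    using add_left_solve[of \<one> \<zero>] by auto
  have neg: "a \<oplus> a \<otimes> e = \<zero>" if "a \<in> C" for a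
    using distrib[of a \<one> e] that e by simp
  have "e \<oplus> e \<otimes> e = e \<oplus> \<one>"
    using neg[OF e(1)] add_inverse_commute[of \<one> e] e by simp
  then have "e \<otimes> e = \<one>"
    using e by (simp only: add_left_cancel closed)
  moreover have "e \<noteq> \<zero>"
    using e by auto
  ultimately show thesis
    using that e neg by blast
qed

abbreviation affine_group where "affine_group \<equiv> grp (affine_s2t F)"

lemma pts_affine [simp]:
  "pts (affine_s2t F) = C" "base0 (affine_s2t F) = \<zero>" "base1 (affine_s2t F) = \<one>"
  by (simp_all add: affine_s2t_def)

lemma affine_apply [simp]: "x \<in> C \<Longrightarrow> affine F a m x = a \<oplus> m \<otimes> x"
  by (simp add: affine_def)

lemma affine_in_group [simp]:
  "a \<in> C \<Longrightarrow> m \<in> C \<Longrightarrow> m \<noteq> \<zero> \<Longrightarrow> affine F a m \<in> affine_group"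
  by (auto simp: affine_s2t_def)

lemma affine_groupE:
  assumes "g \<in> affine_group"
  obtains a m where "a \<in> C" "m \<in> C" "m \<noteq> \<zero>" "g = affine F a m"
  using assms by (auto simp: affine_s2t_def)

lemma affine_bij:
  assumes "g \<in> affine_group"
  shows "g \<in> Bij C"
proof -
  obtain a m where g: "a \<in> C" "m \<in> C" "m \<noteq> \<zero>" "g = affine F a m"
    using affine_groupE[OF assms] by blast
  obtain n where n: "n \<in> C" "m \<otimes> n = \<one>"
    using mult_inverse[OF g(2,3)] by blast
  have "bij_betw g C C"
    unfolding bij_betw_def
  proof (intro conjI equalityI subsetI)
    show "inj_on g C"
      using g by (auto intro: inj_onI)
    show "x \<in> C" if "x \<in> g ` C" for x
      using that g by auto
    show "x \<in> g ` C" if x: "x \<in> C" for x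
    proof -
      obtain y where y: "y \<in> C" "a \<oplus> y = x"
        using add_left_solve[OF g(1) x] by blast
      have "m \<otimes> (n \<otimes> y) = y"
        using mult_assoc[of m n y] n g y by simp
      then have "g (n \<otimes> y) = x"
        using g n y by simp
      then show ?thesis
        using n y by (intro image_eqI[of _ _ "n \<otimes> y"]) auto
    qed
  qed
  then show ?thesis
    using g by (simp add: Bij_def affine_def)
qed

text \<open>
  The factor \<open>d\<close>, by which addition fails to be associative, is absorbed into the multiplication.
\<close>

lemma affine_compose:
  assumes "a \<in> C" "m \<in> C" "m \<noteq> \<zero>" "b \<in> C"
  obtains d where "d \<in> C" "d \<noteq> \<zero>"
    "\<And>n. n \<in> C \<Longrightarrow>
      compose C (affine F a m) (affine F b n) = affine F (a \<oplus> m \<otimes> b) (d \<otimes> (m \<otimes> n))"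
proof -
  obtain d where d: "d \<in> C" "d \<noteq> \<zero>"
      "\<And>x. x \<in> C \<Longrightarrow> a \<oplus> (m \<otimes> b \<oplus> x) = (a \<oplus> m \<otimes> b) \<oplus> (d \<otimes> x)"
    using add_assoc_up_to_scaling[of a "m \<otimes> b"] assms by auto
  have "compose C (affine F a m) (affine F b n) x = affine F (a \<oplus> m \<otimes> b) (d \<otimes> (m \<otimes> n)) x"
    if n: "n \<in> C" for n x
  proof (cases "x \<in> C")
    case True
    have "m \<otimes> (n \<otimes> x) = (m \<otimes> n) \<otimes> x"
      using mult_assoc assms n True by simp
    then show ?thesis
      using d n True assms by (simp add: compose_eq distrib mult_assoc)
  qed (simp add: compose_def affine_def)
  with d that show thesis by blast
qed

lemma affine_subgroup: "subgroup affine_group (BijGroup C)"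
proof (rule group.subgroupI[OF group_BijGroup])
  show "affine_group \<subseteq> carrier (BijGroup C)"
    using affine_bij by (auto simp: BijGroup_def)
  show "affine_group \<noteq> {}"
    using affine_in_group[of \<zero> \<one>] by force
  show "g \<otimes>\<^bsub>BijGroup C\<^esub> h \<in> affine_group" if gh: "g \<in> affine_group" "h \<in> affine_group" for g h
  proof -
    obtain a m where g: "a \<in> C" "m \<in> C" "m \<noteq> \<zero>" "g = affine F a m"
      using affine_groupE[OF gh(1)] by blast
    obtain b n where h: "b \<in> C" "n \<in> C" "n \<noteq> \<zero>" "h = affine F b n"
      using affine_groupE[OF gh(2)] by blast
    obtain d where "d \<in> C" "d \<noteq> \<zero>"
        "compose C g h = affine F (a \<oplus> m \<otimes> b) (d \<otimes> (m \<otimes> n))"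
      using affine_compose[OF g(1-3) h(1)] g h by metis
    then have "compose C g h \<in> affine_group"
      using g h by simp
    then show ?thesis
      using gh affine_bij by (simp add: BijGroup_def)
  qed
  show "inv\<^bsub>BijGroup C\<^esub> g \<in> affine_group" if g_in: "g \<in> affine_group" for g
  proof -
    obtain a m where g: "a \<in> C" "m \<in> C" "m \<noteq> \<zero>" "g = affine F a m"
      using affine_groupE[OF g_in] by blast
    obtain m' where m': "m' \<in> C" "m' \<noteq> \<zero>" "m \<otimes> m' = \<one>"
      using mult_inverse[OF g(2,3)] by blast
    obtain c where c: "c \<in> C" "a \<oplus> c = \<zero>"
      using add_left_solve[OF g(1), of \<zero>] by auto
    \<comment> \<open>The inverse must send \<open>0\<close> to the solution \<open>b\<close> of \<open>a + m b = 0\<close>.\<close>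
    define b where "b = m' \<otimes> c"
    have b: "b \<in> C" "a \<oplus> m \<otimes> b = \<zero>"
      using m' c g mult_assoc[of m m' c] by (simp_all add: b_def)
    obtain d where d: "d \<in> C" "d \<noteq> \<zero>"
        "\<And>n. n \<in> C \<Longrightarrow> compose C g (affine F b n) = affine F \<zero> (d \<otimes> (m \<otimes> n))"
      using affine_compose[OF g(1-3) b(1)] b(2) g by metis
    obtain d' where d': "d' \<in> C" "d' \<noteq> \<zero>" "d \<otimes> d' = \<one>"
      using mult_inverse[OF d(1,2)] by blast
    let ?h = "affine F b (m' \<otimes> d')"
    have h: "?h \<in> affine_group"
      using b m' d' by simp
    have "d \<otimes> (m \<otimes> (m' \<otimes> d')) = \<one>"
      using mult_assoc[of m m' d'] m' d' g by simp
    then have "compose C g ?h = affine F \<zero> \<one>"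
      using d(3)[of "m' \<otimes> d'"] m' d' by simp
    also have "\<dots> = (\<lambda>x\<in>C. x)"
      by (auto simp: affine_def fun_eq_iff)
    finally have "g \<otimes>\<^bsub>BijGroup C\<^esub> ?h = \<one>\<^bsub>BijGroup C\<^esub>"
      using affine_bij[OF g_in] affine_bij[OF h] by (simp add: BijGroup_def)
    moreover have carrier: "g \<in> carrier (BijGroup C)" "?h \<in> carrier (BijGroup C)"
      using affine_bij[OF g_in] affine_bij[OF h] by (simp_all add: BijGroup_def)
    ultimately have "?h \<otimes>\<^bsub>BijGroup C\<^esub> g = \<one>\<^bsub>BijGroup C\<^esub>"
      by (rule group.inv_comm[OF group_BijGroup])
    then have "inv\<^bsub>BijGroup C\<^esub> g = ?h"
      by (rule group.inv_equality[OF group_BijGroup _ carrier])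
    with h show ?thesis by simp
  qed
qed

lemma affine_transport:
  assumes "\<alpha> \<in> C" "\<beta> \<in> C" "\<alpha> \<noteq> \<beta>"
  obtains g where "g \<in> affine_group" "g \<zero> = \<alpha>" "g \<one> = \<beta>"
proof -
  obtain m where m: "m \<in> C" "\<alpha> \<oplus> m = \<beta>"
    using add_left_solve[OF assms(1,2)] by blast
  with assms have "m \<noteq> \<zero>" by auto
  with m assms that[of "affine F \<alpha> m"] show thesis by simp
qed

lemma affine_eqI:
  assumes "g \<in> affine_group" "h \<in> affine_group" "g \<zero> = h \<zero>" "g \<one> = h \<one>"
  shows "g = h"
proof -
  obtain a m where g: "a \<in> C" "m \<in> C" "m \<noteq> \<zero>" "g = affine F a m"
    using affine_groupE[OF assms(1)] by blast
  obtain b n where h: "b \<in> C" "n \<in> C" "n \<noteq> \<zero>" "h = affine F b n"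
    using affine_groupE[OF assms(2)] by blast
  have "a = b" using assms g h by simp
  moreover have "m = n" using assms(4) g h \<open>a = b\<close> by simp
  ultimately show ?thesis using g h by simp
qed

text \<open>
  In a group of permutations it suffices to know sharp transitivity from the fixed pair \<open>(0, 1)\<close>.
\<close>

lemma affine_sharply_2_transitive: "sharply_2_transitive affine_group C"
  unfolding sharply_2_transitive_def
proof (intro conjI ballI impI)
  have compose: "compose C g h \<in> affine_group" if "g \<in> affine_group" "h \<in> affine_group" for g h
    using subgroup.m_closed[OF affine_subgroup that] affine_bij that by (simp add: BijGroup_def)
  fix \<alpha>1 \<alpha>2 \<beta>1 \<beta>2
  assume in_C: "\<alpha>1 \<in> C" "\<alpha>2 \<in> C" "\<beta>1 \<in> C" "\<beta>2 \<in> C" and "\<alpha>1 \<noteq> \<alpha>2 \<and> \<beta>1 \<noteq> \<beta>2"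
  then have neq: "\<alpha>1 \<noteq> \<alpha>2" "\<beta>1 \<noteq> \<beta>2" by auto
  obtain g where g: "g \<in> affine_group" "g \<zero> = \<alpha>1" "g \<one> = \<alpha>2"
    using affine_transport[OF in_C(1,2) neq(1)] by blast
  obtain h where h: "h \<in> affine_group" "h \<zero> = \<beta>1" "h \<one> = \<beta>2"
    using affine_transport[OF in_C(3,4) neq(2)] by blast
  let ?g' = "inv\<^bsub>BijGroup C\<^esub> g"
  have g': "?g' \<in> affine_group"
    by (rule subgroup.m_inv_closed[OF affine_subgroup g(1)])
  have g'_eq: "?g' (g x) = x" "g (?g' x) = x" if "x \<in> C" for x
    using that affine_bij[OF g(1)]
    by (auto simp: inv_BijGroup Bij_def bij_betw_def inv_into_f_f f_inv_into_f)
  show "\<exists>!k. k \<in> affine_group \<and> k \<alpha>1 = \<beta>1 \<and> k \<alpha>2 = \<beta>2"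
  proof (rule ex1I)
    show "compose C h ?g' \<in> affine_group \<and> compose C h ?g' \<alpha>1 = \<beta>1 \<and> compose C h ?g' \<alpha>2 = \<beta>2"
      using compose[OF h(1) g'] in_C h g'_eq(1)[of \<zero>] g'_eq(1)[of \<one>] g
      by (simp add: compose_eq)
    fix k assume k: "k \<in> affine_group \<and> k \<alpha>1 = \<beta>1 \<and> k \<alpha>2 = \<beta>2"
    have "compose C k g = h"
      by (rule affine_eqI) (use k g h compose in \<open>auto simp: compose_eq\<close>)
    have "k x = compose C h ?g' x" for x
    proof (cases "x \<in> C")
      case True
      have "?g' x \<in> C"
        using affine_bij[OF g'] True by (auto simp: Bij_def dest: bij_betwE)
      then have "h (?g' x) = k (g (?g' x))"
        unfolding \<open>compose C k g = h\<close>[symmetric] by (simp add: compose_eq)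
      then show ?thesis
        using True by (simp add: compose_eq g'_eq)
    next
      case False
      then show ?thesis
        using k affine_bij by (auto simp: Bij_def extensional_def compose_def)
    qed
    then show "k = compose C h ?g'" by blast
  qed
next
  show "\<exists>\<alpha>\<in>C. \<exists>\<beta>\<in>C. \<alpha> \<noteq> \<beta>"
    using one_neq_zero closed(1,2) by blast
qed (rule affine_subgroup)

sublocale affine: s2t_object "affine_s2t F"
  by unfold_locales (simp add: is_s2t_def affine_sharply_2_transitive)

text \<open>
  If \<open>e \<noteq> 1\<close>, the map \<open>x \<mapsto> e x\<close> and its conjugates under the multiplications are involutions
  fixing \<open>0\<close>, hence all equal.
\<close>

lemma minus_one_central:
  assumes e: "e \<in> C" "e \<noteq> \<zero>" "e \<otimes> e = \<one>" and a: "a \<in> C"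
  shows "a \<otimes> e = e \<otimes> a"
proof (cases "a = \<zero> \<or> e = \<one>")
  case False
  have \<nu>: "affine F \<zero> e \<in> affine.J"
  proof (rule affine.involutionI)
    show "affine F \<zero> e (affine F \<zero> e x) = x" if "x \<in> pts (affine_s2t F)" for x
      using that e mult_assoc[of e e x] by simp
    show "affine F \<zero> e \<one> \<noteq> \<one>"
      using e False by simp
  qed (use e in simp_all)
  obtain j where j: "j \<in> affine.J"
      "\<And>x. x \<in> C \<Longrightarrow> j (affine F \<zero> a x) = affine F \<zero> a (affine F \<zero> e x)"
    using affine.conjugate_involution[OF \<nu>, of "affine F \<zero> a"] a False by auto
  have "j \<zero> = \<zero>"
    using j(2)[of \<zero>] a e by simp
  then have "j = affine F \<zero> e"
    using affine.involution_fixing_unique[OF j(1) \<nu>, of \<zero>] e by simp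
  then show ?thesis
    using j(2)[of \<one>] a e by simp
qed (use assms in auto)

text \<open>
  By regularity, the translation that sends \<open>0\<close> to \<open>a\<close> is known as soon as some element of the
  regular set with this value is found. Which form of the regular set applies depends on the
  characteristic, so the two are determined together.
\<close>

lemma affine_translation_set:
  assumes a: "a \<in> C"
  shows "affine F a \<one> \<in> affine.translation_set" (is "?thesis1")
    and "char_2 affine_group C \<longleftrightarrow> \<one> \<oplus> \<one> = \<zero>" (is "?thesis2")
proof -
  obtain e where e: "e \<in> C" "e \<noteq> \<zero>" "e \<otimes> e = \<one>" and neg: "\<And>a. a \<in> C \<Longrightarrow> a \<oplus> a \<otimes> e = \<zero>"
    using minus_one by blast
  have one_plus_one: "\<one> \<oplus> \<one> = \<zero> \<longleftrightarrow> e = \<one>"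
    using neg[of \<one>] add_left_cancel[of \<one> \<one> e] e by auto
  have "?thesis1 \<and> ?thesis2"
  proof (cases "e = \<one>")
    case True
    have inv: "affine F a \<one> \<in> affine.J" and fixpoint_free: "\<And>x. x \<in> C \<Longrightarrow> affine F a \<one> x \<noteq> x"
      if a: "a \<in> C" "a \<noteq> \<zero>" for a
    proof -
      show "affine F a \<one> \<in> affine.J"
      proof (rule affine.involutionI)
        show "affine F a \<one> (affine F a \<one> x) = x" if "x \<in> pts (affine_s2t F)" for x
          using that a neg[of a] True add_inverse_cancel[of a a x] by simp
        show "affine F a \<one> \<zero> \<noteq> \<zero>"
          using a by simp
      qed (use a in simp_all)
      show "affine F a \<one> x \<noteq> x" if x: "x \<in> C" for x
        using x a add_right_cancel[of x a \<zero>] by simp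
    qed
    have char: "char_2 affine_group C"
      using affine.char_2_if_fixpoint_free[OF inv[of \<one>]] fixpoint_free[of \<one>] by simp
    have "affine F a \<one> \<in> affine.translation_set"
    proof (cases "a = \<zero>")
      case True
      then have "affine F a \<one> = (\<lambda>x\<in>C. x)"
        by (auto simp: affine_def fun_eq_iff)
      then show ?thesis
        using affine.id_in_regular_set[of \<zero>] by simp
    next
      case False
      then show ?thesis
        using affine.in_regular_set_char_2[of \<zero>] char inv[OF a] by simp
    qed
    with char one_plus_one True show ?thesis by simp
  next
    case False
    have inv: "affine F a e \<in> affine.J" if a: "a \<in> C" for a
    proof (rule affine.involutionI)
      show "affine F a e (affine F a e x) = x" if "x \<in> pts (affine_s2t F)" for x
      proof -
        have x: "x \<in> C" using that by simp
        have "a \<oplus> e \<otimes> (a \<oplus> e \<otimes> x) = a \<oplus> (a \<otimes> e \<oplus> x)"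
          using a e x mult_assoc[of e e x] minus_one_central[OF e a] by (simp add: distrib)
        then show ?thesis
          using x a e add_inverse_cancel[of a "a \<otimes> e" x] neg[OF a] by simp
      qed
      \<comment> \<open>The map moves \<open>0\<close> to \<open>a\<close>; for \<open>a = 0\<close> it still moves \<open>1\<close> to \<open>e \<noteq> 1\<close>.\<close>
      show "affine F a e (if a = \<zero> then \<one> else \<zero>) \<noteq> (if a = \<zero> then \<one> else \<zero>)"
        using a e False by simp
    qed (use a e in simp_all)
    have \<nu>0: "affine F \<zero> e \<zero> = \<zero>"
      using e by simp
    then have char: "\<not> char_2 affine_group C"
      using inv[of \<zero>] unfolding char_2_def pts_affine by (metis closed(1))
    have \<nu>: "base_involution affine_group C \<zero> = affine F \<zero> e"
      using affine.base_involution_eqI[of \<zero> "affine F \<zero> e"] inv[of \<zero>] \<nu>0 by simp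
    have "affine F a \<one> \<in> affine.translation_set"
    proof (rule affine.regular_setI)
      show "affine F a \<one> x = affine F a e (base_involution affine_group (pts (affine_s2t F))
          (base0 (affine_s2t F)) x)" if "x \<in> pts (affine_s2t F)" for x
        using that a e \<nu> mult_assoc[of e e x] by simp
    qed (use a char inv in simp_all)
    with char one_plus_one False show ?thesis by simp
  qed
  then show ?thesis1 ?thesis2 by blast+
qed

lemma s2t_add_affine:
  assumes "a \<in> C" "b \<in> C"
  shows "s2t_add (affine_s2t F) a b = a \<oplus> b"
  using affine.add_eqI[OF affine_translation_set(1)[OF assms(1)]] assms by simp

lemma s2t_mult_affine:
  assumes "a \<in> C" "b \<in> C"
  shows "s2t_mult (affine_s2t F) a b = a \<otimes> b"
proof (cases "a = \<zero>")
  case True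
  with assms show ?thesis
    using affine.base0_mult(1)[of b] by simp
next
  case False
  with assms show ?thesis
    using affine.mult_eqI[of "affine F \<zero> a" a b] by simp
qed

end

lemma char_2_affine:
  assumes "is_neardomain F"
  shows "char_2 (grp (affine_s2t F)) (carrier F) \<longleftrightarrow> \<one>\<^bsub>F\<^esub> \<oplus>\<^bsub>F\<^esub> \<one>\<^bsub>F\<^esub> = \<zero>\<^bsub>F\<^esub>"
proof -
  interpret neardomain F by unfold_locales (rule assms)
  show ?thesis by (rule affine_translation_set(2)[OF closed(1)])
qed

text \<open>
  The equality is literal: an element of the group is a translation after an element of the stabilizer
  of the base point, and the latter is a multiplication.
\<close>

lemma affine_s2t_functor_K:
  assumes "is_s2t X"
  shows "affine_s2t (on_obj functor_K X) = X"
proof -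
  interpret s2t_object X by unfold_locales (rule assms)
  let ?K = "on_obj functor_K X"
  have K [simp]: "carrier ?K = pts X" "add ?K = s2t_add X" "mult ?K = s2t_mult X"
      "zero ?K = base0 X" "one ?K = base1 X"
    by (simp_all add: functor_K_def)
  have "grp (affine_s2t ?K) = grp X"
  proof (intro equalityI subsetI)
    fix h assume "h \<in> grp (affine_s2t ?K)"
    then obtain \<alpha> \<mu> where \<alpha>: "\<alpha> \<in> pts X" "\<mu> \<in> pts X" "\<mu> \<noteq> base0 X" and h: "h = affine ?K \<alpha> \<mu>"
      by (auto simp: affine_s2t_def)
    obtain g where g: "g \<in> grp X" "\<And>\<beta>. \<beta> \<in> pts X \<Longrightarrow> s2t_mult X \<mu> \<beta> = g \<beta>"
      using scaling[OF \<alpha>(2,3)] by metis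
    have "h = compose (pts X) (s2t_add X \<alpha>) g"
      using g by (auto simp: h affine_def compose_def fun_eq_iff)
    then show "h \<in> grp X"
      using g \<alpha> by (simp add: compose_closed)
  next
    fix h assume h: "h \<in> grp X"
    let ?\<alpha> = "h (base0 X)"
    obtain t where t: "t \<in> grp X" "\<And>x. x \<in> pts X \<Longrightarrow> t (s2t_add X ?\<alpha> x) = x"
        "\<And>x. x \<in> pts X \<Longrightarrow> s2t_add X ?\<alpha> (t x) = x"
      using inverse[OF add_in_group[OF closed[OF h base(1)]]] by blast
    let ?g = "compose (pts X) t h"
    have g: "?g \<in> grp X"
      using h t by (simp add: compose_closed)
    have g0: "?g (base0 X) = base0 X"
      using t(2)[OF base(1)] h by (simp add: compose_eq)
    have g1: "?g (base1 X) \<in> pts X - {base0 X}"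
      using inj_iff[OF g base(2,1)] g0 closed[OF g base(2)] by simp
    have "s2t_mult X (?g (base1 X)) x = ?g x" if "x \<in> pts X" for x
      by (rule mult_eqI[OF g g0 refl that])
    then have "affine ?K ?\<alpha> (?g (base1 X)) x = h x" for x
      using t(3) h extensional[OF h] by (simp add: affine_def compose_eq extensional_def)
    then have "affine ?K ?\<alpha> (?g (base1 X)) = h" by blast
    moreover have "affine ?K ?\<alpha> (?g (base1 X)) \<in> grp (affine_s2t ?K)"
      using closed[OF h base(1)] g1 by (auto simp: affine_s2t_def)
    ultimately show "h \<in> grp (affine_s2t ?K)" by simp
  qed
  then show ?thesis
    by (simp add: affine_s2t_def)
qed

section \<open>Morphisms\<close>

lemma s2t_homD:
  assumes "(f, \<Phi>) \<in> s2t_hom X Y"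
  shows "char_2 (grp X) (pts X) \<longleftrightarrow> char_2 (grp Y) (pts Y)"
    "\<And>g. g \<in> grp X \<Longrightarrow> f g \<in> grp Y" "f \<in> extensional (grp X)"
    "\<Phi> \<in> pts X \<rightarrow>\<^sub>E pts Y" "inj_on \<Phi> (pts X)"
    "\<Phi> (base0 X) = base0 Y" "\<Phi> (base1 X) = base1 Y"
    "\<And>g x. g \<in> grp X \<Longrightarrow> x \<in> pts X \<Longrightarrow> f g (\<Phi> x) = \<Phi> (g x)"
  using assms by (auto simp: s2t_hom_def hom_def Pi_iff)

text \<open>
  A map into a sharply 2-transitive group is multiplicative as soon as it is compatible with a map
  of points that has two different values, because elements that agree at two points are equal.
\<close>

lemma equivariant_multiplicative:
  assumes X: "is_s2t X" and Y: "is_s2t Y"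
    and f: "\<And>g. g \<in> grp X \<Longrightarrow> f g \<in> grp Y"
    and \<Phi>: "\<And>x. x \<in> pts X \<Longrightarrow> \<Phi> x \<in> pts Y"
      "\<Phi> (base0 X) = base0 Y" "\<Phi> (base1 X) = base1 Y"
    and equivariant: "\<And>g x. g \<in> grp X \<Longrightarrow> x \<in> pts X \<Longrightarrow> f g (\<Phi> x) = \<Phi> (g x)"
    and gh: "g \<in> grp X" "h \<in> grp X"
  shows "f (compose (pts X) g h) = compose (pts Y) (f g) (f h)"
proof -
  interpret X: s2t_object X by unfold_locales (rule X)
  interpret Y: s2t_object Y by unfold_locales (rule Y)
  have agree: "f (compose (pts X) g h) (\<Phi> x) = compose (pts Y) (f g) (f h) (\<Phi> x)"
    if x: "x \<in> pts X" for x
    using x gh \<Phi>(1) by (simp add: equivariant X.compose_closed compose_eq)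
  show ?thesis
    using agree[OF X.base(1)] agree[OF X.base(2)] \<Phi>(2,3) gh f
    by (intro Y.eqI_base) (simp_all add: X.compose_closed Y.compose_closed)
qed

lemma s2t_homI:
  assumes X: "is_s2t X" and Y: "is_s2t Y"
    and char: "char_2 (grp X) (pts X) \<longleftrightarrow> char_2 (grp Y) (pts Y)"
    and f: "\<And>g. g \<in> grp X \<Longrightarrow> f g \<in> grp Y" "f \<in> extensional (grp X)"
    and \<Phi>: "\<Phi> \<in> pts X \<rightarrow>\<^sub>E pts Y" "inj_on \<Phi> (pts X)"
      "\<Phi> (base0 X) = base0 Y" "\<Phi> (base1 X) = base1 Y"
    and equivariant: "\<And>g x. g \<in> grp X \<Longrightarrow> x \<in> pts X \<Longrightarrow> f g (\<Phi> x) = \<Phi> (g x)"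
  shows "(f, \<Phi>) \<in> s2t_hom X Y"
proof -
  interpret X: s2t_object X by unfold_locales (rule X)
  interpret Y: s2t_object Y by unfold_locales (rule Y)
  have "f (compose (pts X) g h) = compose (pts Y) (f g) (f h)"
    if "g \<in> grp X" "h \<in> grp X" for g h
    by (rule equivariant_multiplicative[OF X Y f(1) PiE_mem[OF \<Phi>(1)] \<Phi>(3,4) equivariant that])
  then have "f \<in> hom (perm_group X) (perm_group Y)"
    using f X.in_Bij Y.in_Bij by (auto simp: hom_def BijGroup_def)
  with assms show ?thesis
    by (simp add: s2t_hom_def)
qed

lemma s2t_hom_eqI:
  assumes "is_s2t Y" "(f, \<Phi>) \<in> s2t_hom X Y" "(f', \<Phi>) \<in> s2t_hom X Y" "is_s2t X"
  shows "f = f'"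
proof (rule extensionalityI[OF s2t_homD(3)[OF assms(2)] s2t_homD(3)[OF assms(3)]])
  interpret X: s2t_object X by unfold_locales (rule assms)
  interpret Y: s2t_object Y by unfold_locales (rule assms)
  note f = s2t_homD[OF assms(2)] and f' = s2t_homD[OF assms(3)]
  fix g assume g: "g \<in> grp X"
  show "f g = f' g"
    using Y.eqI_base[of "f g" "f' g"] f(2)[OF g] f'(2)[OF g]
      f(8)[OF g, of "base0 X"] f'(8)[OF g, of "base0 X"]
      f(8)[OF g, of "base1 X"] f'(8)[OF g, of "base1 X"] f(6,7) by simp
qed

text \<open>
  The homomorphism that accompanies a given map of points; the description picks out a single
  element whenever one exists, because the condition includes both base points.
\<close>

definition lift :: "'a s2t \<Rightarrow> 'a s2t \<Rightarrow> ('a \<Rightarrow> 'a) \<Rightarrow> ('a \<Rightarrow> 'a) \<Rightarrow> 'a \<Rightarrow> 'a" where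
  "lift X Y \<Phi> = (\<lambda>g\<in>grp X. THE h. h \<in> grp Y \<and> (\<forall>x\<in>pts X. h (\<Phi> x) = \<Phi> (g x)))"

lemma lift_hom:
  assumes X: "is_s2t X" and Y: "is_s2t Y"
    and char: "char_2 (grp X) (pts X) \<longleftrightarrow> char_2 (grp Y) (pts Y)"
    and \<Phi>: "\<Phi> \<in> pts X \<rightarrow>\<^sub>E pts Y" "inj_on \<Phi> (pts X)"
      "\<Phi> (base0 X) = base0 Y" "\<Phi> (base1 X) = base1 Y"
    and ex: "\<And>g. g \<in> grp X \<Longrightarrow> \<exists>h\<in>grp Y. \<forall>x\<in>pts X. h (\<Phi> x) = \<Phi> (g x)"
  shows "(lift X Y \<Phi>, \<Phi>) \<in> s2t_hom X Y"
proof -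
  interpret X: s2t_object X by unfold_locales (rule X)
  interpret Y: s2t_object Y by unfold_locales (rule Y)
  have lift: "lift X Y \<Phi> g \<in> grp Y \<and> (\<forall>x\<in>pts X. lift X Y \<Phi> g (\<Phi> x) = \<Phi> (g x))"
    if g: "g \<in> grp X" for g
  proof -
    have "\<exists>!h. h \<in> grp Y \<and> (\<forall>x\<in>pts X. h (\<Phi> x) = \<Phi> (g x))"
      using ex[OF g] Y.eqI_base X.base \<Phi>(3,4) by metis
    from theI'[OF this] show ?thesis
      using g by (simp add: lift_def)
  qed
  show ?thesis
    by (rule s2t_homI[OF X Y char]) (use lift \<Phi> in \<open>auto simp: lift_def\<close>)
qed

text \<open>
  A morphism carries involutions to involutions and, when they have fixpoints, the base involution
  to the base involution; so it carries translations to translations.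
\<close>

lemma s2t_hom_ring_hom:
  assumes X: "is_s2t X" and Y: "is_s2t Y" and hom: "(f, \<Phi>) \<in> s2t_hom X Y"
  shows "\<Phi> \<in> ring_hom (on_obj functor_K X) (on_obj functor_K Y)"
proof -
  interpret X: s2t_object X by unfold_locales (rule X)
  interpret Y: s2t_object Y by unfold_locales (rule Y)
  note f = s2t_homD[OF hom]
  have \<Phi>_in [simp]: "\<Phi> x \<in> pts Y" if "x \<in> pts X" for x
    using PiE_mem[OF f(4) that] .
  have f_id: "f (\<lambda>x\<in>pts X. x) = (\<lambda>x\<in>pts Y. x)"
    using f(8)[OF X.id_closed, of "base0 X"] f(8)[OF X.id_closed, of "base1 X"] f(6,7)
    by (intro Y.eqI_base) (simp_all add: f(2) X.id_closed Y.id_closed)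
  have f_compose: "f (compose (pts X) g h) = compose (pts Y) (f g) (f h)"
    if "g \<in> grp X" "h \<in> grp X" for g h
    by (rule equivariant_multiplicative[OF X Y f(2) \<Phi>_in f(6,7,8) that])
  have f_J: "f j \<in> Y.J" if j: "j \<in> X.J" for j
  proof -
    obtain x where x: "x \<in> pts X" "j x \<noteq> x"
      using X.involution_moves_point[OF j] .
    have "compose (pts X) j j = (\<lambda>x\<in>pts X. x)"
      using j unfolding involutions_def by blast
    then have "compose (pts Y) (f j) (f j) = (\<lambda>x\<in>pts Y. x)"
      using f_compose[of j j] f_id j by simp
    moreover have "f j (\<Phi> x) \<noteq> \<Phi> x"
      unfolding f(8)[OF X.involution_in[OF j] x(1)]
      using inj_on_eq_iff[OF f(5) X.closed[OF X.involution_in[OF j] x(1)] x(1)] x(2) by blast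
    then have "f j \<noteq> (\<lambda>x\<in>pts Y. x)"
      using x by auto
    ultimately show ?thesis
      using f(2)[OF X.involution_in[OF j]] unfolding involutions_def by blast
  qed
  have f_translation: "f a \<in> Y.translation_set" if a: "a \<in> X.translation_set" for a
  proof (cases "char_2 (grp X) (pts X)")
    case True
    then have "char_2 (grp Y) (pts Y)" using f(1) by simp
    then show ?thesis
      using a f_J f_id X.in_regular_set_char_2[OF X.base(1) True]
        Y.in_regular_set_char_2[OF Y.base(1)] by auto
  next
    case False
    then have char: "\<not> char_2 (grp Y) (pts Y)" using f(1) by simp
    let ?\<nu> = "base_involution (grp X) (pts X) (base0 X)"
    note \<nu> = X.base_involution[OF X.base(1) False]
    have "f ?\<nu> (base0 Y) = base0 Y"
      using f(8)[OF X.involution_in[OF \<nu>(1)] X.base(1)] f(6) \<nu>(2) by simp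
    then have "base_involution (grp Y) (pts Y) (base0 Y) = f ?\<nu>"
      by (rule Y.base_involution_eqI[OF Y.base(1) f_J[OF \<nu>(1)]])
    moreover obtain j where j: "j \<in> X.J" "a = compose (pts X) j ?\<nu>"
      using a False by (auto simp: regular_set_def)
    then have "f a = compose (pts Y) (f j) (f ?\<nu>)"
      using f_compose \<nu> by simp
    ultimately show ?thesis
      using char f_J[OF j(1)] by (auto simp: regular_set_def)
  qed
  have "\<Phi> (s2t_add X \<alpha> \<beta>) = s2t_add Y (\<Phi> \<alpha>) (\<Phi> \<beta>)" if "\<alpha> \<in> pts X" "\<beta> \<in> pts X" for \<alpha> \<beta>
  proof -
    have "f (s2t_add X \<alpha>) (base0 Y) = \<Phi> \<alpha>"
      using f(8)[OF X.add_in_group[OF that(1)] X.base(1)] f(6) that by simp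
    then have "s2t_add Y (\<Phi> \<alpha>) = f (s2t_add X \<alpha>)"
      by (rule Y.add_eqI[OF f_translation[OF X.add_translation(1)[OF that(1)]]])
    then show ?thesis
      using f(8) that by simp
  qed
  moreover have "\<Phi> (s2t_mult X \<alpha> \<beta>) = s2t_mult Y (\<Phi> \<alpha>) (\<Phi> \<beta>)"
    if in_pts: "\<alpha> \<in> pts X" "\<beta> \<in> pts X" for \<alpha> \<beta>
  proof (cases "\<alpha> = base0 X")
    case False
    obtain g where g: "g \<in> grp X" "g (base0 X) = base0 X" "g (base1 X) = \<alpha>"
        "\<And>\<beta>. \<beta> \<in> pts X \<Longrightarrow> s2t_mult X \<alpha> \<beta> = g \<beta>"
      using X.scaling[OF in_pts(1) False] by blast
    have "s2t_mult Y (\<Phi> \<alpha>) (\<Phi> \<beta>) = f g (\<Phi> \<beta>)"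
      by (rule Y.mult_eqI)
         (use f(2,6,7) g in_pts f(8)[OF g(1), of "base0 X"] f(8)[OF g(1), of "base1 X"] in simp_all)
    then show ?thesis
      using g in_pts f(8) by simp
  qed (simp add: f(6))
  ultimately show ?thesis
    using f(7) by (auto intro!: ring_hom_memI simp: functor_K_def)
qed

lemma neardomain_hom_zero:
  assumes "is_neardomain F" "is_neardomain F'" "\<phi> \<in> ring_hom F F'"
  shows "\<phi> \<zero>\<^bsub>F\<^esub> = \<zero>\<^bsub>F'\<^esub>"
proof -
  interpret F: neardomain F by unfold_locales (rule assms)
  interpret F': neardomain F' by unfold_locales (rule assms)
  have "\<phi> \<zero>\<^bsub>F\<^esub> \<in> carrier F'"
    using ring_hom_closed[OF assms(3)] by simp
  moreover from this have "\<phi> \<zero>\<^bsub>F\<^esub> \<oplus>\<^bsub>F'\<^esub> \<phi> \<zero>\<^bsub>F\<^esub> = \<phi> \<zero>\<^bsub>F\<^esub> \<oplus>\<^bsub>F'\<^esub> \<zero>\<^bsub>F'\<^esub>"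
    using ring_hom_add[OF assms(3), of "\<zero>\<^bsub>F\<^esub>" "\<zero>\<^bsub>F\<^esub>"] by simp
  ultimately show ?thesis
    by (simp only: F'.add_left_cancel F'.closed)
qed

text \<open>
  If \<open>\<phi> x = \<phi> (x + c)\<close>, cancellation gives \<open>\<phi> c = 0\<close>, so \<open>c\<close> cannot be invertible, since \<open>\<phi> 1 \<noteq> 0\<close>.
\<close>

lemma neardomain_hom_inj:
  assumes "is_neardomain F" "is_neardomain F'" "\<phi> \<in> ring_hom F F'"
  shows "inj_on \<phi> (carrier F)"
proof (rule inj_onI, rule ccontr)
  interpret F: neardomain F by unfold_locales (rule assms)
  interpret F': neardomain F' by unfold_locales (rule assms)
  note \<phi> = ring_hom_closed[OF assms(3)] ring_hom_add[OF assms(3)] ring_hom_mult[OF assms(3)]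
    ring_hom_one[OF assms(3)]
  fix x y assume xy: "x \<in> carrier F" "y \<in> carrier F" "\<phi> x = \<phi> y" "x \<noteq> y"
  obtain c where c: "c \<in> carrier F" "x \<oplus>\<^bsub>F\<^esub> c = y"
    using F.add_left_solve[OF xy(1,2)] by blast
  have "\<phi> x \<oplus>\<^bsub>F'\<^esub> \<phi> c = \<phi> x \<oplus>\<^bsub>F'\<^esub> \<zero>\<^bsub>F'\<^esub>"
    using \<phi>(2)[OF xy(1) c(1)] c xy \<phi>(1) by simp
  then have "\<phi> c = \<zero>\<^bsub>F'\<^esub>"
    using \<phi>(1) xy c by (simp only: F'.add_left_cancel F'.closed)
  moreover have "c \<noteq> \<zero>\<^bsub>F\<^esub>"
    using c xy by auto
  then obtain b where "b \<in> carrier F" "c \<otimes>\<^bsub>F\<^esub> b = \<one>\<^bsub>F\<^esub>"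
    using F.mult_inverse[OF c(1)] by blast
  ultimately show False
    using \<phi>(3)[OF c(1), of b] \<phi>(1,4) by simp
qed

lemma affine_lift_hom:
  assumes F: "is_neardomain F" and F': "is_neardomain F'"
    and \<phi>: "\<phi> \<in> ring_hom F F'" "\<phi> \<in> extensional (carrier F)"
  shows "(lift (affine_s2t F) (affine_s2t F') \<phi>, \<phi>) \<in> s2t_hom (affine_s2t F) (affine_s2t F')"
proof -
  interpret F: neardomain F by unfold_locales (rule F)
  interpret F': neardomain F' by unfold_locales (rule F')
  note hom = ring_hom_closed[OF \<phi>(1)] ring_hom_add[OF \<phi>(1)] ring_hom_mult[OF \<phi>(1)]
    ring_hom_one[OF \<phi>(1)] neardomain_hom_zero[OF F F' \<phi>(1)]
  note inj = neardomain_hom_inj[OF F F' \<phi>(1)]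
  show ?thesis
  proof (rule lift_hom[OF F.affine.object F'.affine.object])
    have "\<one>\<^bsub>F\<^esub> \<oplus>\<^bsub>F\<^esub> \<one>\<^bsub>F\<^esub> = \<zero>\<^bsub>F\<^esub> \<longleftrightarrow> \<phi> (\<one>\<^bsub>F\<^esub> \<oplus>\<^bsub>F\<^esub> \<one>\<^bsub>F\<^esub>) = \<phi> \<zero>\<^bsub>F\<^esub>"
      using inj_on_eq_iff[OF inj, of "\<one>\<^bsub>F\<^esub> \<oplus>\<^bsub>F\<^esub> \<one>\<^bsub>F\<^esub>" "\<zero>\<^bsub>F\<^esub>"] by simp
    then show "char_2 (grp (affine_s2t F)) (pts (affine_s2t F)) \<longleftrightarrow>
        char_2 (grp (affine_s2t F')) (pts (affine_s2t F'))"
      using hom by (simp add: char_2_affine F F')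
    show "\<phi> \<in> pts (affine_s2t F) \<rightarrow>\<^sub>E pts (affine_s2t F')"
      using hom \<phi> by (simp add: PiE_def)
    fix g assume "g \<in> grp (affine_s2t F)"
    then obtain a m where g: "a \<in> carrier F" "m \<in> carrier F" "m \<noteq> \<zero>\<^bsub>F\<^esub>" "g = affine F a m"
      using F.affine_groupE by blast
    have "\<phi> m \<noteq> \<zero>\<^bsub>F'\<^esub>"
      using inj_on_eq_iff[OF inj g(2), of "\<zero>\<^bsub>F\<^esub>"] hom g by simp
    then show "\<exists>h\<in>grp (affine_s2t F'). \<forall>x\<in>pts (affine_s2t F). h (\<phi> x) = \<phi> (g x)"
      using g hom by (intro bexI[of _ "affine F' (\<phi> a) (\<phi> m)"]) simp_all
  qed (use hom inj in simp_all)
qed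

section \<open>The equivalence\<close>

lemma is_category_s2t_Gp: "is_category (s2t_Gp :: ('a s2t, _) cat)"
proof -
  have id: "(\<lambda>g\<in>grp X. g, \<lambda>x\<in>pts X. x) \<in> s2t_hom X X" if X: "is_s2t X" for X :: "'a s2t"
  proof -
    interpret X: s2t_object X by unfold_locales (rule X)
    show ?thesis
      by (rule s2t_homI[OF X X]) (auto simp: inj_on_def)
  qed
  have comp: "(compose (grp X) f' f, compose (pts X) \<Phi>' \<Phi>) \<in> s2t_hom X Z"
    if X: "is_s2t X" and Z: "is_s2t Z"
      and f: "(f, \<Phi>) \<in> s2t_hom X Y" and f': "(f', \<Phi>') \<in> s2t_hom Y Z"
    for X Y Z :: "'a s2t" and f f' \<Phi> \<Phi>'
  proof -
    interpret X: s2t_object X by unfold_locales (rule X)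
    note f = s2t_homD[OF f] and f' = s2t_homD[OF f']
    have \<Phi>: "\<Phi> x \<in> pts Y" if "x \<in> pts X" for x
      using PiE_mem[OF f(4) that] .
    show ?thesis
    proof (rule s2t_homI[OF X Z])
      show "compose (pts X) \<Phi>' \<Phi> \<in> pts X \<rightarrow>\<^sub>E pts Z"
        using f(4) f'(4) by (auto simp: PiE_def Pi_iff compose_eq)
      show "inj_on (compose (pts X) \<Phi>' \<Phi>) (pts X)"
        using f(5) f'(5) \<Phi> by (auto simp: inj_on_def compose_eq)
    qed (use f(1,2,6-8) f'(1,2,6-8) \<Phi> in \<open>simp_all add: compose_eq\<close>)
  qed
  show ?thesis
    unfolding is_category_def
  proof (intro conjI ballI)
    fix X :: "'a s2t" assume "X \<in> obj s2t_Gp"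
    then show "idm s2t_Gp X \<in> hom_set s2t_Gp X X"
      by (simp add: s2t_Gp_def id)
  next
    fix X Y Z :: "'a s2t" and f g
    assume "X \<in> obj s2t_Gp" "Y \<in> obj s2t_Gp" "Z \<in> obj s2t_Gp"
      "f \<in> hom_set s2t_Gp X Y" "g \<in> hom_set s2t_Gp Y Z"
    then show "cmp s2t_Gp X Y Z g f \<in> hom_set s2t_Gp X Z"
      by (cases f; cases g) (simp add: s2t_Gp_def comp)
  next
    fix X Y :: "'a s2t" and p
    assume "X \<in> obj s2t_Gp" "Y \<in> obj s2t_Gp" "p \<in> hom_set s2t_Gp X Y"
    then obtain f \<Phi> where p: "p = (f, \<Phi>)" "(f, \<Phi>) \<in> s2t_hom X Y"
      by (cases p) (simp add: s2t_Gp_def)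
    have "f \<in> grp X \<rightarrow> grp Y" "f \<in> extensional (grp X)"
        "\<Phi> \<in> pts X \<rightarrow> pts Y" "\<Phi> \<in> extensional (pts X)"
      using s2t_homD(2-4)[OF p(2)] by (auto simp: PiE_def)
    then show "cmp s2t_Gp X X Y p (idm s2t_Gp X) = p" "cmp s2t_Gp X Y Y (idm s2t_Gp Y) p = p"
      by (simp_all add: s2t_Gp_def p(1) compose_Id[where B = "grp Y"] compose_Id[where B = "pts Y"])
  next
    fix W X Y Z :: "'a s2t" and p q r
    assume "p \<in> hom_set s2t_Gp W X" "q \<in> hom_set s2t_Gp X Y" "r \<in> hom_set s2t_Gp Y Z"
    then obtain f \<Phi> g \<Psi> h \<Theta> where p: "p = (f, \<Phi>)" "(f, \<Phi>) \<in> s2t_hom W X"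
      and q: "q = (g, \<Psi>)" "r = (h, \<Theta>)"
      by (cases p; cases q; cases r) (simp add: s2t_Gp_def)
    note f = s2t_homD[OF p(2)]
    show "cmp s2t_Gp W Y Z r (cmp s2t_Gp W X Y q p) = cmp s2t_Gp W X Z (cmp s2t_Gp X Y Z r q) p"
      using f(2,4) by (simp add: s2t_Gp_def p(1) q compose_assoc[of _ _ "grp X"]
        compose_assoc[of _ _ "pts X"] PiE_def Pi_iff)
  qed
qed

lemma is_category_n_Dom: "is_category (n_Dom :: ('a ring, _) cat)"
proof -
  have closed: "\<phi> \<in> carrier F \<rightarrow> carrier F'" if "\<phi> \<in> ring_hom F F'" for \<phi> and F F' :: "'a ring"
    using that by (simp add: ring_hom_def)
  have id: "(\<lambda>x\<in>carrier F. x) \<in> ring_hom F F" if F: "is_neardomain F" for F :: "'a ring"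
  proof -
    interpret F: neardomain F by unfold_locales (rule F)
    show ?thesis by (rule ring_hom_memI) simp_all
  qed
  have comp: "compose (carrier F) \<psi> \<phi> \<in> ring_hom F F''"
    if F: "is_neardomain F" and \<phi>: "\<phi> \<in> ring_hom F F'" and \<psi>: "\<psi> \<in> ring_hom F' F''"
    for \<phi> \<psi> and F F' F'' :: "'a ring"
  proof -
    interpret F: neardomain F by unfold_locales (rule F)
    show ?thesis
      using ring_hom_memE[OF \<phi>] ring_hom_memE[OF \<psi>]
      by (intro ring_hom_memI) (simp_all add: compose_eq)
  qed
  show ?thesis
    unfolding is_category_def
  proof (intro conjI ballI)
    fix F :: "'a ring" assume "F \<in> obj n_Dom"
    then show "idm n_Dom F \<in> hom_set n_Dom F F"
      by (simp add: n_Dom_def id)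
  qed (auto simp: n_Dom_def comp compose_assoc closed intro: compose_Id[OF closed])
qed

definition affine_functor ::
  "('a ring, 'a \<Rightarrow> 'a, 'a s2t, (('a \<Rightarrow> 'a) \<Rightarrow> ('a \<Rightarrow> 'a)) \<times> ('a \<Rightarrow> 'a)) funct" where
  "affine_functor =
    \<lparr>on_obj = affine_s2t,
     on_mor = (\<lambda>F F' \<phi>. (lift (affine_s2t F) (affine_s2t F') \<phi>, \<phi>))\<rparr>"

lemma is_functor_K: "is_functor s2t_Gp n_Dom (functor_K :: ('a s2t, _, _, _) funct)"
  unfolding is_functor_def
proof (intro conjI ballI is_category_s2t_Gp is_category_n_Dom)
  fix X :: "'a s2t" assume "X \<in> obj s2t_Gp"
  then show "on_obj functor_K X \<in> obj n_Dom"
    by (simp add: s2t_Gp_def n_Dom_def s2t_object.neardomain s2t_object.intro)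
next
  fix X :: "'a s2t"
  show "on_mor functor_K X X (idm s2t_Gp X) = idm n_Dom (on_obj functor_K X)"
    by (simp add: s2t_Gp_def n_Dom_def functor_K_def)
next
  fix X Y :: "'a s2t" and p
  assume "X \<in> obj s2t_Gp" "Y \<in> obj s2t_Gp" "p \<in> hom_set s2t_Gp X Y"
  then obtain f \<Phi> where p: "p = (f, \<Phi>)" "is_s2t X" "is_s2t Y" "(f, \<Phi>) \<in> s2t_hom X Y"
    by (cases p) (simp add: s2t_Gp_def)
  have "\<Phi> \<in> extensional (carrier (on_obj functor_K X))"
    using s2t_homD(4)[OF p(4)] by (simp add: functor_K_def PiE_def)
  moreover have "on_mor functor_K X Y p = \<Phi>"
    by (simp add: functor_K_def p(1))
  ultimately show
    "on_mor functor_K X Y p \<in> hom_set n_Dom (on_obj functor_K X) (on_obj functor_K Y)"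
    using s2t_hom_ring_hom[OF p(2-4)] by (simp add: n_Dom_def)
next
  fix X Y Z :: "'a s2t" and p q
  show "on_mor functor_K X Z (cmp s2t_Gp X Y Z q p) =
      cmp n_Dom (on_obj functor_K X) (on_obj functor_K Y) (on_obj functor_K Z)
        (on_mor functor_K Y Z q) (on_mor functor_K X Y p)"
    by (cases p; cases q) (simp add: s2t_Gp_def n_Dom_def functor_K_def)
qed

lemma s2t_Gp_hom_eqI:
  assumes "X \<in> obj s2t_Gp" "Y \<in> obj s2t_Gp" "p \<in> hom_set s2t_Gp X Y" "q \<in> hom_set s2t_Gp X Y"
    "snd p = snd q"
  shows "p = q"
  using assms s2t_hom_eqI[of Y "fst p" "snd p" X "fst q"]
  by (cases p; cases q) (simp add: s2t_Gp_def)

lemma is_functor_affine: "is_functor n_Dom s2t_Gp (affine_functor :: ('a ring, _, _, _) funct)"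
proof -
  note category = is_category_s2t_Gp[where ?'a = 'a] is_category_n_Dom[where ?'a = 'a]
  have obj: "on_obj affine_functor F \<in> obj s2t_Gp" if "F \<in> obj n_Dom" for F :: "'a ring"
  proof -
    interpret F: neardomain F
      using that by unfold_locales (simp add: n_Dom_def)
    show ?thesis
      using F.affine.object by (simp add: s2t_Gp_def affine_functor_def)
  qed
  have mor: "on_mor affine_functor F F' \<phi> \<in>
      hom_set s2t_Gp (on_obj affine_functor F) (on_obj affine_functor F')"
    if "F \<in> obj n_Dom" "F' \<in> obj n_Dom" "\<phi> \<in> hom_set n_Dom F F'" for F F' :: "'a ring" and \<phi>
    using that by (simp add: n_Dom_def s2t_Gp_def affine_functor_def affine_lift_hom)
  have "on_mor affine_functor F F (idm n_Dom F) = idm s2t_Gp (on_obj affine_functor F)"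
    if F: "F \<in> obj n_Dom" for F :: "'a ring"
  proof (rule s2t_Gp_hom_eqI[OF obj[OF F] obj[OF F]])
    show "on_mor affine_functor F F (idm n_Dom F) \<in>
        hom_set s2t_Gp (on_obj affine_functor F) (on_obj affine_functor F)"
      by (rule mor[OF F F]) (use category F in \<open>simp add: is_category_def\<close>)
    show "idm s2t_Gp (on_obj affine_functor F) \<in>
        hom_set s2t_Gp (on_obj affine_functor F) (on_obj affine_functor F)"
      using category obj[OF F] by (simp add: is_category_def)
  qed (simp add: affine_functor_def n_Dom_def s2t_Gp_def affine_s2t_def)
  moreover have "on_mor affine_functor F F'' (cmp n_Dom F F' F'' \<psi> \<phi>) =
      cmp s2t_Gp (on_obj affine_functor F) (on_obj affine_functor F') (on_obj affine_functor F'')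
        (on_mor affine_functor F' F'' \<psi>) (on_mor affine_functor F F' \<phi>)"
    if F: "F \<in> obj n_Dom" "F' \<in> obj n_Dom" "F'' \<in> obj n_Dom"
      and \<phi>: "\<phi> \<in> hom_set n_Dom F F'" and \<psi>: "\<psi> \<in> hom_set n_Dom F' F''"
    for F F' F'' :: "'a ring" and \<phi> \<psi>
  proof (rule s2t_Gp_hom_eqI[OF obj[OF F(1)] obj[OF F(3)]])
    have "cmp n_Dom F F' F'' \<psi> \<phi> \<in> hom_set n_Dom F F''"
      using category(2) F \<phi> \<psi> unfolding is_category_def by blast
    then show "on_mor affine_functor F F'' (cmp n_Dom F F' F'' \<psi> \<phi>) \<in>
        hom_set s2t_Gp (on_obj affine_functor F) (on_obj affine_functor F'')"
      by (rule mor[OF F(1,3)])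
    show "cmp s2t_Gp (on_obj affine_functor F) (on_obj affine_functor F')
          (on_obj affine_functor F'') (on_mor affine_functor F' F'' \<psi>)
          (on_mor affine_functor F F' \<phi>)
        \<in> hom_set s2t_Gp (on_obj affine_functor F) (on_obj affine_functor F'')"
      using category(1) obj[OF F(1)] obj[OF F(2)] obj[OF F(3)]
        mor[OF F(1,2) \<phi>] mor[OF F(2,3) \<psi>]
      unfolding is_category_def by blast
  qed (simp add: affine_functor_def n_Dom_def s2t_Gp_def affine_s2t_def)
  ultimately show ?thesis
    unfolding is_functor_def using category obj mor by blast
qed

text \<open>
  The composite functor fixes every object and every morphism, so the identities form the natural
  isomorphism.
\<close>

lemma affine_functor_K_naturally_isomorphic:
  "naturally_isomorphic s2t_Gp (s2t_Gp :: ('a s2t, _) cat)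
     (comp_functor affine_functor functor_K) id_functor"
proof -
  let ?LK = "comp_functor affine_functor (functor_K :: ('a s2t, _, _, _) funct)"
  note category = is_category_s2t_Gp[where ?'a = 'a]
  have obj: "on_obj ?LK X = X" if "X \<in> obj s2t_Gp" for X :: "'a s2t"
    using that affine_s2t_functor_K by (simp add: comp_functor_def affine_functor_def s2t_Gp_def)
  have mor: "on_mor ?LK X Y p = p"
    if XY: "X \<in> obj s2t_Gp" "Y \<in> obj s2t_Gp" and p: "p \<in> hom_set s2t_Gp X Y"
    for X Y :: "'a s2t" and p
  proof (rule s2t_Gp_hom_eqI[OF XY _ p])
    have K: "on_obj functor_K X \<in> obj n_Dom" "on_obj functor_K Y \<in> obj n_Dom"
        "on_mor functor_K X Y p \<in> hom_set n_Dom (on_obj functor_K X) (on_obj functor_K Y)"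
      using is_functor_K XY p unfolding is_functor_def by blast+
    have "on_mor affine_functor (on_obj functor_K X) (on_obj functor_K Y) (on_mor functor_K X Y p)
        \<in> hom_set s2t_Gp (on_obj affine_functor (on_obj functor_K X))
            (on_obj affine_functor (on_obj functor_K Y))"
      using is_functor_affine K unfolding is_functor_def by blast
    then show "on_mor ?LK X Y p \<in> hom_set s2t_Gp X Y"
      using obj[OF XY(1)] obj[OF XY(2)] by (simp add: comp_functor_def)
  qed (simp add: comp_functor_def affine_functor_def functor_K_def split: prod.split)
  show ?thesis
    unfolding naturally_isomorphic_def
  proof (intro exI[of _ "idm s2t_Gp"] conjI ballI)
    fix X :: "'a s2t" assume X: "X \<in> obj s2t_Gp"
    then show "idm s2t_Gp X \<in> isomorphisms s2t_Gp (on_obj ?LK X) (on_obj id_functor X)"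
      using category obj[OF X] unfolding isomorphisms_def is_category_def id_functor_def
      by auto
  next
    fix X Y :: "'a s2t" and p
    assume "X \<in> obj s2t_Gp" "Y \<in> obj s2t_Gp" "p \<in> hom_set s2t_Gp X Y"
    then show "cmp s2t_Gp (on_obj ?LK X) (on_obj ?LK Y) (on_obj id_functor Y) (idm s2t_Gp Y)
          (on_mor ?LK X Y p) =
        cmp s2t_Gp (on_obj ?LK X) (on_obj id_functor X) (on_obj id_functor Y)
          (on_mor id_functor X Y p) (idm s2t_Gp X)"
      using category obj mor unfolding is_category_def id_functor_def by simp
  qed
qed

text \<open>
  The neardomains \<open>K (L F)\<close>, with \<open>L\<close> the affine functor, and \<open>F\<close> have the same carrier and the same
  operations on it; they may differ only in the irrelevant values of the operations outside the
  carrier. So the isomorphism is the identity of the carrier, but the objects are not equal.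
\<close>

lemma functor_K_affine_naturally_isomorphic:
  "naturally_isomorphic n_Dom (n_Dom :: ('a ring, _) cat)
     (comp_functor functor_K affine_functor) id_functor"
proof -
  let ?KL = "comp_functor functor_K (affine_functor :: ('a ring, _, _, _) funct)"
  have carrier [simp]: "carrier (on_obj ?KL F) = carrier F" for F :: "'a ring"
    by (simp add: comp_functor_def functor_K_def affine_functor_def affine_s2t_def)
  show ?thesis
    unfolding naturally_isomorphic_def
  proof (intro exI[of _ "idm n_Dom"] conjI ballI)
    fix F :: "'a ring" assume "F \<in> obj n_Dom"
    then interpret F: neardomain F
      by unfold_locales (simp add: n_Dom_def)
    have "(\<lambda>x\<in>carrier F. x) \<in> ring_hom (on_obj ?KL F) F"
      "(\<lambda>x\<in>carrier F. x) \<in> ring_hom F (on_obj ?KL F)"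
      by (auto intro!: ring_hom_memI simp: comp_functor_def functor_K_def affine_functor_def
        F.s2t_add_affine F.s2t_mult_affine)
    moreover have "compose (carrier F) (\<lambda>x\<in>carrier F. x) (\<lambda>x\<in>carrier F. x) = (\<lambda>x\<in>carrier F. x)"
      by (auto simp: compose_def)
    ultimately show "idm n_Dom F \<in> isomorphisms n_Dom (on_obj ?KL F) (on_obj id_functor F)"
      by (auto simp: isomorphisms_def n_Dom_def id_functor_def
        intro!: bexI[of _ "\<lambda>x\<in>carrier F. x"])
  next
    fix F F' :: "'a ring" and \<phi>
    assume "\<phi> \<in> hom_set n_Dom F F'"
    then have "\<phi> \<in> carrier F \<rightarrow> carrier F'" "\<phi> \<in> extensional (carrier F)"
      by (simp_all add: n_Dom_def ring_hom_def)
    moreover have "on_mor ?KL F F' \<phi> = \<phi>"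
      by (simp add: comp_functor_def functor_K_def affine_functor_def)
    ultimately show "cmp n_Dom (on_obj ?KL F) (on_obj ?KL F') (on_obj id_functor F')
          (idm n_Dom F') (on_mor ?KL F F' \<phi>) =
        cmp n_Dom (on_obj ?KL F) (on_obj id_functor F) (on_obj id_functor F')
          (on_mor id_functor F F' \<phi>) (idm n_Dom F)"
      by (simp add: n_Dom_def id_functor_def)
  qed
qed

theorem theorem4p1:
  shows "is_equivalence (s2t_Gp :: ('a s2t, (('a \<Rightarrow> 'a) \<Rightarrow> ('a \<Rightarrow> 'a)) \<times> ('a \<Rightarrow> 'a)) cat)
           (n_Dom :: ('a ring, 'a \<Rightarrow> 'a) cat) functor_K"
  unfolding is_equivalence_def
  using is_functor_K is_functor_affine affine_functor_K_naturally_isomorphic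
    functor_K_affine_naturally_isomorphic by blast

end
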